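(* Let $\mathbf{M}=(M_p)_{p\in\mathbb{N}_0}$ be a strongly regular sequence and let $0<\delta<\gamma(\mathbf{M})$. Let $e_{\mathbf{M}}$ be the kernel and $\mathfrak{m}=(m(p))_{p\in\mathbb{N}_0}$ the sequence of moments described in the context. Then there exists a constant $c\ge1$ such that for every $A>0$ there is $R_0>0$ for which the integral operator $$T_{\mathbf{M},A}\big(\mathbf{a}=(a_p)_{p\in\mathbb{N}_0}\big)(z):=\int_0^{R_0}e_{\mathbf{M}}(u/z)\Big(\sum_{p=0}^\infty\frac{a_p}{m(p)}\frac{u^p}{p!}\Big)\frac{du}{u},\qquad z\in S_\delta,$$ defines a linear and continuous map $T_{\mathbf{M},A}:\Lambda_{\mathbf{M},A}(\mathbb{N}_0)\to\mathcal{A}_{\mathbf{M},cA}(S_\delta)$ which is a right inverse for the asymptotic Borel map, i.e. $\mathcal{B}(T_{\mathbf{M},A}\mathbf{a})=\mathbf{a}$ for every $\mathbf{a}\in\Lambda_{\mathbf{M},A}(\mathbb{N}_0)$.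
   Context: A sequence $\mathbf{M}=(M_p)_{p\ge0}$ of positive reals with $M_0=1$ is strongly regular if: ($\alpha_0$) $M_p^2\le M_{p-1}M_{p+1}$ for $p\ge1$; ($\mu$) there is $A>0$ with $M_{p+\ell}\le A^{p+\ell}M_pM_\ell$ for all $p,\ell\ge0$; ($\gamma_1$) there is $B>0$ with $\sum_{\ell\ge p}\frac{M_\ell}{(\ell+1)M_{\ell+1}}\le B\frac{M_p}{M_{p+1}}$. Put $m_p=M_{p+1}/M_p$, $h_{\mathbf{M}}(t)=\inf_pM_pt^p$ ($t>0$), $h_{\mathbf{M}}(0)=0$. $\mathbf{M}$ satisfies $(P_\gamma)$ ($\gamma>0$) if there are reals $(m'_p)$, $a\ge1$ with $a^{-1}m_p\le m'_p\le am_p$ ($p\in\mathbb{N}$) and $((p+1)^{-\gamma}m'_p)_p$ increasing; $\gamma(\mathbf{M})=\sup\{\gamma:(P_\gamma)\}\in(0,\infty)$. $\mathcal{R}$ is the Riemann surface of the logarithm and $S_\gamma=\{z\in\mathcal{R}:|\arg z|<\gamma\pi/2\}$. Kernel: fix $\delta'$ with $\delta\le\delta'<\gamma(\mathbf{M})$, then $\delta_1,s$ with $\delta'<\delta_1<\gamma(\mathbf{M})$, $s\delta_1<1<s\gamma(\mathbf{M})$, let $\mathbf{M}^s=(M_p^s)$ and for $z\in S_{\delta_1}$, $G_{\mathbf{M}}(z)=\exp\big(\frac{1}{\pi}\int_{-\infty}^{\infty}\log(h_{\mathbf{M}^s}(|t|))\frac{itz^s-1}{it-z^s}\frac{dt}{1+t^2}\big)$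 (principal branch of $z^s$); put $e_{\mathbf{M}}(z)=zG_{\mathbf{M}}(1/z)$ for $z\in S_{\delta'}$ and $m(p)=\int_0^\infty t^{p-1}e_{\mathbf{M}}(t)\,dt$ (finite positive reals). For a sector $S$ and $A>0$, $\mathcal{A}_{\mathbf{M},A}(S)$ is the Banach space of holomorphic $f$ on $S$ with norm $\|f\|_{\mathbf{M},A,S}=\sup_{p\in\mathbb{N}_0,z\in S}\frac{|f^{(p)}(z)|}{A^pp!M_p}<\infty$; $\Lambda_{\mathbf{M},A}(\mathbb{N}_0)$ is the Banach space of complex sequences $\boldsymbol\lambda=(\lambda_p)$ with norm $|\boldsymbol\lambda|_{\mathbf{M},A}=\sup_p\frac{|\lambda_p|}{A^pp!M_p}<\infty$. For $f\in\mathcal{A}_{\mathbf{M},A}(S)$ the limits $f^{(p)}(0)=\lim_{z\to0,z\in S}f^{(p)}(z)$ exist, and the asymptotic Borel map is $\mathcal{B}(f)=(f^{(p)}(0))_{p\in\mathbb{N}_0}$. *)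

theory Defs
  imports "HOL-Analysis.Analysis"
begin

text \<open>Points of the Riemann surface of the logarithm are represented by their
logarithm w (z = exp w, arg z = Im w). A sector S_gamma = {|arg z| < gamma pi/2}
becomes the horizontal strip below; holomorphic functions f on the sector are
represented by F = f o exp, holomorphic on the strip.\<close>

definition strip :: "real \<Rightarrow> complex set" where
  "strip g = {w. \<bar>Im w\<bar> < g * pi / 2}"

text \<open>Iterated derivative with respect to z = exp w: f^(p)(exp w) = zderiv p F w.\<close>
fun zderiv :: "nat \<Rightarrow> (complex \<Rightarrow> complex) \<Rightarrow> complex \<Rightarrow> complex" where
  "zderiv 0 F = F"
| "zderiv (Suc n) F = (\<lambda>w. exp (- w) * deriv (zderiv n F) w)"

definition strongly_regular :: "(nat \<Rightarrow> real) \<Rightarrow> bool" where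
  "strongly_regular M \<longleftrightarrow>
     (\<forall>p. M p > 0) \<and> M 0 = 1 \<and>
     (\<forall>p\<ge>1. (M p)\<^sup>2 \<le> M (p - 1) * M (p + 1)) \<and>
     (\<exists>A>0. \<forall>p l. M (p + l) \<le> A ^ (p + l) * M p * M l) \<and>
     (\<exists>B>0. \<forall>p. summable (\<lambda>k. M (p + k) / ((real (p + k) + 1) * M (p + k + 1))) \<and>
        (\<Sum>k. M (p + k) / ((real (p + k) + 1) * M (p + k + 1))) \<le> B * M p / M (p + 1))"

definition quot_seq :: "(nat \<Rightarrow> real) \<Rightarrow> nat \<Rightarrow> real" where
  "quot_seq M p = M (p + 1) / M p"

definition P_gamma :: "(nat \<Rightarrow> real) \<Rightarrow> real \<Rightarrow> bool" where
  "P_gamma M g \<longleftrightarrow> (\<exists>m' :: nat \<Rightarrow> real. \<exists>a \<ge> 1.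
      (\<forall>p. quot_seq M p / a \<le> m' p \<and> m' p \<le> a * quot_seq M p) \<and>
      incseq (\<lambda>p. m' p / (real p + 1) powr g))"

definition gammaM :: "(nat \<Rightarrow> real) \<Rightarrow> real" where
  "gammaM M = Sup {g. g > 0 \<and> P_gamma M g}"

definition hM :: "(nat \<Rightarrow> real) \<Rightarrow> real \<Rightarrow> real" where
  "hM M t = (if t = 0 then 0 else Inf (range (\<lambda>p. M p * t ^ p)))"

text \<open>G_M in logarithmic coordinates: Glog M s v = G_M(exp v), with z^s = exp (s v).\<close>
definition Glog :: "(nat \<Rightarrow> real) \<Rightarrow> real \<Rightarrow> complex \<Rightarrow> complex" where
  "Glog M s v = exp (complex_of_real (1 / pi) *
     (LINT t|lborel. complex_of_real (ln (hM (\<lambda>p. M p powr s) \<bar>t\<bar>)) *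
        ((\<i> * complex_of_real t * exp (complex_of_real s * v) - 1) /
         (\<i> * complex_of_real t - exp (complex_of_real s * v))) /
        complex_of_real (1 + t\<^sup>2)))"

text \<open>Kernel e_M(z) = z G_M(1/z) in logarithmic coordinates: elog M s w = e_M(exp w).\<close>
definition elog :: "(nat \<Rightarrow> real) \<Rightarrow> real \<Rightarrow> complex \<Rightarrow> complex" where
  "elog M s w = exp w * Glog M s (- w)"

definition mom :: "(nat \<Rightarrow> real) \<Rightarrow> real \<Rightarrow> nat \<Rightarrow> complex" where
  "mom M s p = (LINT t:{0<..}|lborel.
      complex_of_real (t powr (real p - 1)) * elog M s (complex_of_real (ln t)))"

definition in_Lambda :: "(nat \<Rightarrow> real) \<Rightarrow> real \<Rightarrow> (nat \<Rightarrow> complex) \<Rightarrow> bool" where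
  "in_Lambda M A a \<longleftrightarrow> bdd_above (range (\<lambda>p. cmod (a p) / (A ^ p * fact p * M p)))"

definition Lambda_norm :: "(nat \<Rightarrow> real) \<Rightarrow> real \<Rightarrow> (nat \<Rightarrow> complex) \<Rightarrow> real" where
  "Lambda_norm M A a = (SUP p. cmod (a p) / (A ^ p * fact p * M p))"

definition in_AMA :: "(nat \<Rightarrow> real) \<Rightarrow> real \<Rightarrow> complex set \<Rightarrow> (complex \<Rightarrow> complex) \<Rightarrow> bool" where
  "in_AMA M A S F \<longleftrightarrow> F holomorphic_on S \<and>
     bdd_above {cmod (zderiv p F w) / (A ^ p * fact p * M p) | p w. w \<in> S}"

definition AMA_norm :: "(nat \<Rightarrow> real) \<Rightarrow> real \<Rightarrow> complex set \<Rightarrow> (complex \<Rightarrow> complex) \<Rightarrow> real" where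
  "AMA_norm M A S F = Sup {cmod (zderiv p F w) / (A ^ p * fact p * M p) | p w. w \<in> S}"

text \<open>z \<rightarrow> 0 within the sector corresponds to Re w \<rightarrow> -infinity within the strip.\<close>
definition to_zero_in :: "complex set \<Rightarrow> complex filter" where
  "to_zero_in S = inf (filtercomap Re at_bot) (principal S)"

definition asymp_Borel :: "complex set \<Rightarrow> (complex \<Rightarrow> complex) \<Rightarrow> nat \<Rightarrow> complex" where
  "asymp_Borel S F = (\<lambda>p. Lim (to_zero_in S) (zderiv p F))"

definition T_op :: "(nat \<Rightarrow> real) \<Rightarrow> real \<Rightarrow> real \<Rightarrow> (nat \<Rightarrow> complex) \<Rightarrow> complex \<Rightarrow> complex" where
  "T_op M s R0 a = (\<lambda>w. LINT u:{0<..<R0}|lborel.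
      elog M s (complex_of_real (ln u) - w) *
      (\<Sum>p. a p / mom M s p * complex_of_real (u ^ p / fact p)) / complex_of_real u)"

end

theory Submission
  imports Defs "HOL-Complex_Analysis.Complex_Analysis" "HOL-Probability.Sinc_Integral"
begin

text \<open>
  Write \<open>m\<^sub>p = M\<^sub>p\<^sub>+\<^sub>1 / M\<^sub>p\<close>, \<open>h\<close> for the infimum function of \<open>M^s\<close> and \<open>\<zeta> = z^s\<close>, which lies in a
  proper subsector of the right half plane. Then \<open>ln |G(z)|\<close> is the Poisson integral of \<open>ln h \<le> 0\<close> at
  \<open>\<zeta>\<close>. Keeping only \<open>|t| \<le> |\<zeta>|\<close> bounds \<open>|G(z)|\<close> by a fixed power of \<open>M\<^sub>q |z|^q\<close>, and moderate growth
  absorbs the exponent: \<open>|G(z)| \<le> K^q M\<^sub>q |z|^q\<close> for all \<open>q\<close>. Conversely \<open>(P\<^sub>g)\<close> with \<open>s g > 1\<close> gives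
  \<open>- ln h(t) \<le> C (p + 1) (1 + (m\<^sub>p^s t)^(-1/(s g)))\<close>, hence \<open>G(x) \<ge> exp (- C' (p + 1))\<close> for real
  \<open>x \<ge> 1/m\<^sub>p\<close> and the moments satisfy \<open>m(p) \<ge> c\<^sub>1 c\<^sub>2^p M\<^sub>p\<close>.

  With \<open>b\<^sub>p = a\<^sub>p / (m(p) p!)\<close> the Taylor monomial \<open>a\<^sub>p z^p / p!\<close> is the transform of \<open>b\<^sub>p u^p\<close> over all of
  \<open>(0, \<infinity>)\<close>. So the Taylor remainder of order \<open>N\<close> of \<open>T a\<close> is the transform of the series cut off at
  \<open>R\<^sub>0\<close> minus its \<open>N\<close>-th partial sum; if \<open>R\<^sub>0\<close> is half the guaranteed radius of convergence, this
  difference is at most a constant times \<open>(u / R\<^sub>0)^N\<close> for every \<open>u > 0\<close>. The remainder is therefore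
  bounded by \<open>C D^N M\<^sub>N |z|^N\<close> on a sector larger than \<open>S\<^sub>\<delta>\<close>, with \<open>D\<close> proportional to \<open>A\<close>, and
  Cauchy's estimates on discs of radius \<open>\<rho> |z|\<close> give the derivative bounds and the boundary values.
\<close>

section \<open>Strongly regular sequences\<close>

locale moderate_growth =
  fixes M :: "nat \<Rightarrow> real" and A :: real
  assumes M_pos: "\<And>p. M p > 0" and M_0: "M 0 = 1"
    and quot_mono: "mono (quot_seq M)"
    and A_ge_1: "A \<ge> 1"
    and moderate: "\<And>p l. M (p + l) \<le> A ^ (p + l) * M p * M l"
begin

lemma quot_pos: "quot_seq M p > 0"
  using M_pos by (simp add: quot_seq_def)

lemma M_Suc: "M (Suc p) = quot_seq M p * M p"
  using M_pos[of p] by (simp add: quot_seq_def)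

lemma quot_power_mult_le: "quot_seq M p ^ k * M p \<le> M (p + k)"
proof (induction k)
  case (Suc k)
  have "quot_seq M p ^ Suc k * M p = quot_seq M p * (quot_seq M p ^ k * M p)" by simp
  also have "\<dots> \<le> quot_seq M (p + k) * M (p + k)"
    using Suc quot_pos[of p] M_pos[of p]
    by (intro mult_mono monoD[OF quot_mono]) (auto intro: less_imp_le quot_pos)
  finally show ?case by (simp add: M_Suc)
qed simp

lemma le_mult_quot_power: "q \<le> p \<Longrightarrow> M p \<le> M q * quot_seq M p ^ (p - q)"
proof (induction p rule: dec_induct)
  case (step p)
  have "M (Suc p) \<le> quot_seq M p * (M q * quot_seq M p ^ (p - q))"
    using step quot_pos[of p] by (simp add: M_Suc)
  also have "\<dots> = M q * quot_seq M p ^ (Suc p - q)"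
    using step by (simp add: Suc_diff_le)
  also have "\<dots> \<le> M q * quot_seq M (Suc p) ^ (Suc p - q)"
    using M_pos[of q] quot_pos[of p] 
    by (intro mult_left_mono power_mono monoD[OF quot_mono]) auto
  finally show ?case .
qed simp

lemma le_quot_power: "M p \<le> quot_seq M p ^ p"
  using le_mult_quot_power[of 0 p] by (simp add: M_0)

text \<open>Converse of \<open>le_quot_power\<close> up to a geometric factor: the p quotients
  following index p are at least the p-th one, and moderate growth bounds \<open>M (p + p)\<close>
  by \<open>M p\<close> squared.\<close>

lemma quot_power_le: "quot_seq M p ^ p \<le> A ^ (2 * p) * M p"
proof -
  have "quot_seq M p ^ p * M p \<le> A ^ (p + p) * M p * M p"
    using quot_power_mult_le[of p p] moderate[of p p] by linarith
  then show ?thesis using M_pos[of p] by (simp add: mult_2)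
qed

text \<open>Later used to absorb an n-th root in the bound for G. Splitting off one block of length
  q at a time costs \<open>Suc n * q\<close> factors of \<open>A\<close>, and n + 1 + n * n is at
  most the square of n + 1.\<close>

lemma moderate_mult: "M (n * q) \<le> A ^ (n * n * q) * M q ^ n"
proof (induction n)
  case (Suc n)
  have "M (Suc n * q) \<le> A ^ (Suc n * q) * M (n * q) * M q"
    using moderate[of "n * q" q] by (simp add: add.commute)
  also have "\<dots> \<le> A ^ (Suc n * q) * (A ^ (n * n * q) * M q ^ n) * M q"
    using Suc A_ge_1 M_pos[of q] by (intro mult_right_mono mult_left_mono) auto
  also have "\<dots> = A ^ (Suc n * q + n * n * q) * M q ^ Suc n"
    by (simp add: power_add)
  also have "\<dots> \<le> A ^ (Suc n * Suc n * q) * M q ^ Suc n"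
    using A_ge_1 M_pos[of q]
    by (intro mult_right_mono power_increasing) (auto simp: algebra_simps)
  finally show ?case .
qed (simp add: M_0)

text \<open>Compare (2p)-th powers: \<open>quot_power_le\<close> at 2p costs 4p factors of
  \<open>A\<close>, splitting \<open>M (2 * p)\<close> costs 2p more, and 6p = 3 (2p) leaves the
  cube after taking the root.\<close>

lemma quot_double_le: "quot_seq M (2 * p) \<le> A ^ 3 * quot_seq M p"
proof (cases "p = 0")
  case False
  have "quot_seq M (2 * p) ^ (2 * p) \<le> A ^ (2 * (2 * p)) * M (2 * p)"
    by (rule quot_power_le)
  also have "\<dots> \<le> A ^ (2 * (2 * p)) * (A ^ (2 * p) * M p * M p)"
    using moderate[of p p] A_ge_1 by (intro mult_left_mono) (auto simp: mult_2)
  also have "\<dots> \<le> A ^ (2 * (2 * p)) * (A ^ (2 * p) * quot_seq M p ^ p * quot_seq M p ^ p)"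
    using A_ge_1 M_pos[of p] quot_pos[of p]
    by (intro mult_left_mono mult_mono le_quot_power) auto
  also have "\<dots> = (A ^ 3 * quot_seq M p) ^ (2 * p)"
  proof -
    have "A ^ (2 * (2 * p)) * A ^ (2 * p) = (A ^ 3) ^ (2 * p)"
      by (simp flip: power_add power_mult)
    moreover have "quot_seq M p ^ p * quot_seq M p ^ p = quot_seq M p ^ (2 * p)"
      by (simp add: mult_2 power_add)
    ultimately show ?thesis by (simp only: power_mult_distrib mult.assoc[symmetric]) (simp add: mult.assoc)
  qed
  finally show ?thesis
    using False A_ge_1 quot_pos[of p] quot_pos[of "2 * p"]
    by (subst (asm) power_mono_iff) auto
qed (use A_ge_1 quot_pos[of 0] in simp)

end

section \<open>From strong regularity to growth of the quotients\<close>

lemma strongly_regular_moderate_growth: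
  assumes "strongly_regular M"
  obtains A where "moderate_growth M A"
proof -
  have pos: "\<And>p. M p > 0" and "M 0 = 1"
    and lc: "\<And>p. p \<ge> 1 \<Longrightarrow> (M p)\<^sup>2 \<le> M (p - 1) * M (p + 1)"
    using assms by (auto simp: strongly_regular_def)
  obtain A where A: "A > 0" "\<And>p l. M (p + l) \<le> A ^ (p + l) * M p * M l"
    using assms by (auto simp: strongly_regular_def)
  have "moderate_growth M (max 1 A)"
  proof
    show "mono (quot_seq M)"
      unfolding mono_iff_le_Suc
    proof
      fix n
      show "quot_seq M n \<le> quot_seq M (Suc n)"
        using lc[of "Suc n"] pos[of n] pos[of "Suc n"]
        by (simp add: quot_seq_def divide_simps power2_eq_square mult.commute)
    qed
    fix p l
    have "M (p + l) \<le> A ^ (p + l) * (M p * M l)" using A(2)[of p l] by (simp only: mult.assoc)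
    also have "\<dots> \<le> max 1 A ^ (p + l) * (M p * M l)"
      using A pos[of p] pos[of l] by (intro mult_right_mono power_mono) auto
    finally show "M (p + l) \<le> max 1 A ^ (p + l) * M p * M l" by (simp only: mult.assoc)
  qed (use pos \<open>M 0 = 1\<close> in auto)
  then show ?thesis by (rule that)
qed

text \<open>The reciprocal tails of the series in the last condition of strong regularity serve as the
  sequence comparable to the quotients.\<close>
lemma strongly_regular_P_gamma:
  assumes "strongly_regular M"
  shows "\<exists>g>0. P_gamma M g"
proof -
  obtain A where "moderate_growth M A"
    using strongly_regular_moderate_growth[OF assms] .
  then interpret moderate_growth M A .
  define f where "f p = 1 / ((real p + 1) * quot_seq M p)" for p
  have f_eq: "M p / ((real p + 1) * M (p + 1)) = f p" for p
    using M_pos by (simp add: f_def quot_seq_def)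
  have f_pos: "f p > 0" for p
    using quot_pos by (simp add: f_def)
  define T where "T p = (\<Sum>k. f (p + k))" for p
  obtain B where B: "B > 0" "\<And>p. summable (\<lambda>k. f (p + k))" "\<And>p. T p \<le> B * M p / M (p + 1)"
    using assms unfolding strongly_regular_def f_eq T_def by (auto simp: f_eq)
  have T_upper: "T p \<le> B / quot_seq M p" for p
    using B(3)[of p] M_pos by (simp add: quot_seq_def)
  have T_pos: "T p > 0" for p
    unfolding T_def using B(2) f_pos by (intro suminf_pos) auto
  have T_step: "T p = f p + T (Suc p)" for p
    using suminf_split_head[OF B(2)[of p]] by (simp add: T_def)
  \<comment> \<open>The first p + 1 terms of the tail have indices up to 2p, so each is at least
    \<open>1 / ((2 * real p + 1) * quot_seq M (2 * p))\<close>; doubling returns to index p.\<close>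
  have T_lower: "1 / (2 * A ^ 3 * quot_seq M p) \<le> T p" for p
  proof -
    have "1 / (2 * A ^ 3 * quot_seq M p) \<le> 1 / (2 * quot_seq M (2 * p))"
      using quot_double_le[of p] quot_pos[of p] quot_pos[of "2*p"] A_ge_1
      by (intro divide_left_mono) auto
    also have "\<dots> \<le> (real p + 1) * (1 / ((2 * real p + 1) * quot_seq M (2 * p)))"
      using quot_pos[of "2*p"] by (simp add: divide_simps)
    also have "\<dots> = (\<Sum>k<Suc p. 1 / ((2 * real p + 1) * quot_seq M (2 * p)))"
      by (simp only: sum_constant) simp
    also have "\<dots> \<le> (\<Sum>k<Suc p. f (p + k))"
    proof (rule sum_mono)
      fix k assume "k \<in> {..<Suc p}"
      then show "1 / ((2 * real p + 1) * quot_seq M (2 * p)) \<le> f (p + k)"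
        unfolding f_def using quot_pos[of "2*p"] quot_pos[of "p+k"]
        by (intro divide_left_mono mult_mono monoD[OF quot_mono]) auto
    qed
    also have "\<dots> \<le> T p"
      unfolding T_def using B(2) f_pos by (intro sum_le_suminf) (auto intro: less_imp_le)
    finally show ?thesis .
  qed
  define a where "a = max B (2 * A ^ 3)"
  have "a \<ge> 1" using one_le_power[OF A_ge_1, of 3] unfolding a_def by linarith
  have "quot_seq M p / a \<le> 1 / T p" for p
  proof -
    have "quot_seq M p / a \<le> quot_seq M p / B"
      using B(1) quot_pos[of p] by (intro divide_left_mono) (auto simp: a_def)
    also have "\<dots> \<le> 1 / T p"
      using T_upper[of p] T_pos[of p] B(1) quot_pos[of p] by (simp add: divide_simps mult.commute)
    finally show ?thesis .
  qed
  moreover have "1 / T p \<le> a * quot_seq M p" for p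
  proof -
    have "1 / T p \<le> 2 * A ^ 3 * quot_seq M p"
      using T_lower[of p] T_pos[of p] A_ge_1 quot_pos[of p] by (simp add: divide_simps mult_ac)
    also have "\<dots> \<le> a * quot_seq M p"
      using quot_pos[of p] by (intro mult_right_mono) (auto simp: a_def)
    finally show ?thesis .
  qed
  \<comment> \<open>Origin of the exponent \<open>1 / B\<close>: by \<open>T_upper\<close> the first
    term \<open>f p\<close> is at least the fraction x / B of \<open>T p\<close>, so the tail
    shrinks by the factor exp (- x / B) or more, while the power grows by at most exp (x /
    B).\<close>
  moreover have "1 / T p / (real p + 1) powr (1 / B) \<le> 1 / T (Suc p) / (real (Suc p) + 1) powr (1 / B)" for p
  proof -
    define x where "x = 1 / (real p + 1)"
    have "T p \<le> B * ((real p + 1) * f p)"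
      using T_upper[of p] quot_pos[of p] by (simp add: f_def)
    then have "f p \<ge> x / B * T p"
      using B(1) by (simp add: x_def divide_simps mult_ac)
    then have "T (Suc p) \<le> T p * (1 - x / B)" using T_step[of p] by (simp add: algebra_simps)
    also have "\<dots> \<le> T p * exp (- x / B)"
      using exp_ge_add_one_self[of "- x / B"] T_pos[of p] by (intro mult_left_mono) auto
    finally have 1: "T (Suc p) \<le> T p * exp (- x / B)" .
    have "real (Suc p) + 1 = (real p + 1) * (1 + x)" by (simp add: x_def field_simps)
    also have "\<dots> \<le> (real p + 1) * exp x" by (intro mult_left_mono) auto
    finally have "(real (Suc p) + 1) powr (1 / B) \<le> ((real p + 1) * exp x) powr (1 / B)"
      using B(1) by (intro powr_mono2) auto
    also have "\<dots> = (real p + 1) powr (1 / B) * exp (x / B)"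
      by (subst powr_mult) (auto simp: powr_def)
    finally have "T (Suc p) * (real (Suc p) + 1) powr (1 / B)
        \<le> (T p * exp (- x / B)) * ((real p + 1) powr (1 / B) * exp (x / B))"
      using 1 T_pos[of "Suc p"] T_pos[of p] by (intro mult_mono) auto
    also have "\<dots> = T p * (real p + 1) powr (1 / B)"
      by (simp add: exp_minus field_simps)
    finally show ?thesis
      using T_pos[of "Suc p"] T_pos[of p] by (simp add: divide_simps mult_ac)
  qed
  ultimately have "P_gamma M (1 / B)"
    unfolding P_gamma_def using \<open>a \<ge> 1\<close>
    by (intro exI[of _ "\<lambda>p. 1 / T p"] exI[of _ a]) (auto intro!: incseq_SucI)
  with B(1) show ?thesis by (intro exI[of _ "1 / B"]) auto
qed

text \<open>Eliminates the comparison sequence of \<open>P_gamma\<close>: passing from the quotients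
  to it at p and back at j costs a factor \<open>a\<close> each time.\<close>

lemma P_gamma_quot_growth:
  assumes "P_gamma M g"
  obtains a where "a \<ge> 1"
    "\<And>p j. p \<le> j \<Longrightarrow> quot_seq M p / a\<^sup>2 * ((real j + 1) / (real p + 1)) powr g \<le> quot_seq M j"
proof -
  obtain m' a where a: "a \<ge> 1" "\<And>p. quot_seq M p / a \<le> m' p" "\<And>p. m' p \<le> a * quot_seq M p"
    and inc: "incseq (\<lambda>p. m' p / (real p + 1) powr g)"
    using assms by (auto simp: P_gamma_def)
  have "quot_seq M p / a\<^sup>2 * ((real j + 1) / (real p + 1)) powr g \<le> quot_seq M j" if "p \<le> j" for p j
  proof -
    have "quot_seq M p / a\<^sup>2 * ((real j + 1) / (real p + 1)) powr g
        = (quot_seq M p / a) / (real p + 1) powr g * (real j + 1) powr g / a"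
      using a(1) by (simp add: powr_divide power2_eq_square field_simps)
    also have "\<dots> \<le> m' p / (real p + 1) powr g * (real j + 1) powr g / a"
      using a by (intro divide_right_mono mult_right_mono) auto
    also have "\<dots> \<le> m' j / (real j + 1) powr g * (real j + 1) powr g / a"
      using a incseqD[OF inc that] by (intro divide_right_mono mult_right_mono) auto
    also have "\<dots> \<le> quot_seq M j"
      using a(1) a(3)[of j] by (simp add: field_simps)
    finally show ?thesis .
  qed
  with a(1) show ?thesis by (rule that)
qed

text \<open>\<open>Sup\<close> of an unbounded set of reals is an unspecified value, so that case
  picks a large exponent directly. In the bounded case \<open>strongly_regular_P_gamma\<close>
  supplies nonemptiness.\<close>

lemma less_gammaM_obtains_P_gamma:
  assumes "strongly_regular M" "x < gammaM M"
  obtains g where "g > 0" "P_gamma M g" "x < g"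
proof (cases "bdd_above {g. g > 0 \<and> P_gamma M g}")
  case True
  then have "\<exists>g\<in>{g. g > 0 \<and> P_gamma M g}. x < g"
    using assms strongly_regular_P_gamma[OF assms(1)]
    by (subst less_cSup_iff[symmetric]) (auto simp: gammaM_def)
  then show ?thesis using that by auto
next
  case False
  then show ?thesis using that by (force simp: bdd_above_def not_le)
qed

text \<open>Here \<open>d\<close> is the opening of the sector on which G is studied:
  \<open>s * d < 1\<close> keeps z^s away from the imaginary directions, and
  \<open>1 < s * g\<close> makes the singularity of ln h at 0 integrable. \<open>quot_growth\<close>
  is the form of \<open>P_gamma\<close> given by \<open>P_gamma_quot_growth\<close>.\<close>

locale kernel = moderate_growth +
  fixes g a s d :: real
  assumes a_ge_1: "a \<ge> 1" and g_pos: "g > 0" and s_pos: "s > 0" and d_pos: "d > 0"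
    and sd: "s * d < 1" and sg: "1 < s * g"
    and quot_growth: "\<And>p j. p \<le> j \<Longrightarrow>
      quot_seq M p / a\<^sup>2 * ((real j + 1) / (real p + 1)) powr g \<le> quot_seq M j"
begin

text \<open>The factor c q multiplies the growth factors of \<open>quot_growth\<close> over all
  indices below q, hence the factorial. From q = p upwards each step of the induction is one use of
  \<open>quot_growth\<close>; below p log-convexity suffices, because there c q is at most 1. The
  power of \<open>A\<close> is the loss in \<open>quot_power_le\<close>.\<close>

lemma M_ge_fact_powr:
  "quot_seq M p ^ q * (1 / A ^ (2 * p) * (fact q / ((real p + 1) * (a\<^sup>2) powr (1 / g)) ^ q) powr g) \<le> M q"
proof -
  define b where "b = (a\<^sup>2) powr (1 / g)"
  have bg: "b powr g = a\<^sup>2" using g_pos a_ge_1 by (simp add: b_def powr_powr)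
  have b1: "b \<ge> 1" using g_pos a_ge_1 by (simp add: b_def ge_one_powr_ge_zero)
  have *: "quot_seq M p ^ p * (1 / A ^ (2 * p)) \<le> M p"
    using quot_power_le[of p] A_ge_1 by (simp add: divide_simps mult.commute)
  define c where "c q = (fact q / ((real p + 1) * b) ^ q) powr g" for q
  have c_Suc: "c (Suc q) = (1 / a\<^sup>2 * ((real q + 1) / (real p + 1)) powr g) * c q" for q
  proof -
    have "fact (Suc q) / ((real p + 1) * b) ^ Suc q
        = (1 / b * ((real q + 1) / (real p + 1))) * (fact q / ((real p + 1) * b) ^ q)"
      using b1 by (simp add: field_simps)
    then show ?thesis
      unfolding c_def using b1 by (simp add: powr_mult powr_divide bg)
  qed
  have c_le: "q \<le> p \<Longrightarrow> c q \<le> 1" for q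
  proof (induction q)
    case 0
    then show ?case by (simp add: c_def)
  next
    case (Suc q)
    have "c (Suc q) \<le> (1 * 1) * 1"
      unfolding c_Suc using Suc a_ge_1 one_le_power[OF a_ge_1, of 2] g_pos
      by (intro mult_mono powr_le1) (auto simp: c_def)
    then show ?case by simp
  qed
  have "quot_seq M p ^ q * (1 / A ^ (2 * p) * c q) \<le> M q"
  proof (cases "q \<le> p")
    case True
    have "quot_seq M p ^ q * (1 / A ^ (2 * p) * c q) \<le> quot_seq M p ^ q * (1 / A ^ (2 * p) * 1)"
      using c_le[OF True] quot_pos[of p] A_ge_1 by (intro mult_left_mono) auto
    also have "quot_seq M p ^ q * (1 / A ^ (2 * p) * 1) * quot_seq M p ^ (p - q) = quot_seq M p ^ (q + (p - q)) * (1 / A ^ (2 * p))"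
      by (simp add: power_add)
    then have "quot_seq M p ^ q * (1 / A ^ (2 * p) * 1) * quot_seq M p ^ (p - q) \<le> M p"
      using * True by (simp only: le_add_diff_inverse)
    then have "quot_seq M p ^ q * (1 / A ^ (2 * p) * 1) * quot_seq M p ^ (p - q) \<le> M q * quot_seq M p ^ (p - q)"
      using le_mult_quot_power[OF True] by linarith
    then have "quot_seq M p ^ q * (1 / A ^ (2 * p) * 1) \<le> M q"
      using quot_pos[of p] zero_less_power[OF quot_pos[of p], of "p - q"]
      by (simp only: mult_le_cancel_right_pos)
    finally show ?thesis .
  next
    case False
    then have "p \<le> q" by simp
    then show ?thesis
    proof (induction q rule: dec_induct)
      case base
      have "quot_seq M p ^ p * (1 / A ^ (2 * p) * c p) \<le> quot_seq M p ^ p * (1 / A ^ (2 * p) * 1)"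
        using c_le[of p] quot_pos[of p] A_ge_1 by (intro mult_left_mono) auto
      with * show ?case by simp
    next
      case (step q)
      have "quot_seq M p ^ Suc q * (1 / A ^ (2 * p) * c (Suc q))
          = (quot_seq M p / a\<^sup>2 * ((real q + 1) / (real p + 1)) powr g)
            * (quot_seq M p ^ q * (1 / A ^ (2 * p) * c q))"
        by (simp add: c_Suc mult_ac)
      also have "\<dots> \<le> quot_seq M q * M q"
        using step quot_growth[of p q] quot_pos[of p] quot_pos[of q] A_ge_1
        by (intro mult_mono) (auto simp: c_def intro!: mult_nonneg_nonneg)
      finally show ?case by (simp add: M_Suc)
    qed
  qed
  then show ?thesis by (simp add: c_def b_def)
qed

text \<open>The left-hand side comes from \<open>Y ^ q / q! \<le> exp Y\<close>, with \<open>Y\<close> chosen so that the previous lower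
  bound becomes \<open>(q! / Y ^ q) powr g\<close>; it does not depend on \<open>q\<close>.\<close>
lemma M_power_ge_exp:
  assumes "t > 0"
  shows "exp (- (2 * real p * ln A + g * (real p + 1) * (a\<^sup>2) powr (1 / g)
          * (quot_seq M p * t) powr (- 1 / g))) \<le> M q * t ^ q"
proof -
  define m where "m = quot_seq M p"
  have m: "m > 0" unfolding m_def by (rule quot_pos)
  define Y where "Y = (real p + 1) * (a\<^sup>2) powr (1 / g) * (m * t) powr (- 1 / g)"
  have Y: "Y > 0" using a_ge_1 m assms by (simp add: Y_def)
  have exp_eq_suminf: "exp Y = (\<Sum>n. inverse (fact n) * Y ^ n)"
    by (simp add: exp_def)
  have "Y ^ q / fact q \<le> exp Y"
    using sum_le_suminf[OF summable_exp[of Y], of "{q}"] Y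
    by (simp add: exp_eq_suminf divide_inverse mult.commute)
  then have "exp (- Y) \<le> fact q / Y ^ q"
    using Y by (simp add: exp_minus divide_simps mult.commute)
  then have "exp (- Y) powr g \<le> (fact q / Y ^ q) powr g"
    using g_pos by (intro powr_mono2) auto
  then have e: "exp (- g * Y) \<le> (fact q / Y ^ q) powr g"
    by (simp add: powr_def)
  have Yq: "(fact q / ((real p + 1) * (a\<^sup>2) powr (1 / g)) ^ q) powr g * (m * t) ^ q = (fact q / Y ^ q) powr g"
  proof -
    have "((m * t) powr (1 / g)) ^ q = (m * t) powr (real q / g)"
      using m assms by (simp add: powr_powr flip: powr_realpow)
    then have "(((m * t) powr (1 / g)) ^ q) powr g = (m * t) ^ q"
      using m assms g_pos by (simp add: powr_powr powr_realpow)
    moreover have "fact q / Y ^ q = fact q / ((real p + 1) * (a\<^sup>2) powr (1 / g)) ^ q * ((m * t) powr (1 / g)) ^ q"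
      using m assms by (simp add: Y_def power_mult_distrib powr_minus field_simps)
    moreover have "(x * y) powr g = x powr g * y powr g" if "x \<ge> 0" "y \<ge> 0" for x y :: real
      using that by (simp add: powr_mult)
    ultimately show ?thesis
      by (simp only: zero_le_power powr_ge_zero divide_nonneg_nonneg fact_ge_zero mult_nonneg_nonneg
           of_nat_0_le_iff add_nonneg_nonneg zero_le_one)
  qed
  have "exp (- (2 * real p * ln A + g * Y)) = 1 / A ^ (2 * p) * exp (- g * Y)"
    using A_ge_1 by (simp add: exp_diff exp_minus exp_add divide_simps ln_realpow[symmetric] powr_realpow[symmetric] powr_def)
  also have "\<dots> \<le> 1 / A ^ (2 * p) * (fact q / Y ^ q) powr g"
    using e A_ge_1 by (intro mult_left_mono) auto
  also have "\<dots> = m ^ q * (1 / A ^ (2 * p) * (fact q / ((real p + 1) * (a\<^sup>2) powr (1 / g)) ^ q) powr g) * t ^ q"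
    unfolding Yq[symmetric] by (simp add: power_mult_distrib)
  also have "\<dots> \<le> M q * t ^ q"
    using M_ge_fact_powr[of p q] assms unfolding m_def by (intro mult_right_mono) auto
  finally show ?thesis by (simp add: Y_def m_def mult.assoc)
qed

end

section \<open>Integrals depending on a parameter and the Poisson kernel\<close>

text \<open>Cauchy's inequality on discs of radius e / 4, centred in the half-size ball, bounds the
  derivative by 4 B / e; the mean value inequality then bounds the quotient.\<close>

lemma norm_diff_quotient_le:
  assumes hol: "f holomorphic_on ball w e" and B: "\<And>y. y \<in> ball w e \<Longrightarrow> norm (f y) \<le> B"
    and y: "y \<in> ball w (e / 2)" "y \<noteq> w"
  shows "norm ((f y - f w) / (y - w)) \<le> 2 * B / (e / 2)"
proof -
  have e: "e > 0" using y zero_le_dist[of w y] by (simp only: mem_ball)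
  have "norm (f y - f w) \<le> 2 * B / (e / 2) * norm (y - w)"
  proof (rule field_differentiable_bound)
    show "convex (ball w (e / 2))" by simp
    fix x assume x: "x \<in> ball w (e / 2)"
    have sub: "cball x (e / 4) \<subseteq> ball w e"
    proof
      fix z assume "z \<in> cball x (e / 4)"
      then show "z \<in> ball w e" using x e dist_triangle[of w z x] by (simp add: dist_commute)
    qed
    have "x \<in> ball w e" using x e by simp
    then show "(f has_field_derivative deriv f x) (at x within ball w (e / 2))"
      using hol by (meson holomorphic_derivI open_ball)
    have "norm ((deriv ^^ 1) f x) \<le> fact 1 * B / (e / 4) ^ 1"
    proof (rule Cauchy_inequality)
      show "f holomorphic_on ball x (e / 4)"
        using hol sub ball_subset_cball by (blast intro: holomorphic_on_subset)
      show "continuous_on (cball x (e / 4)) f"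
        using hol sub by (meson holomorphic_on_imp_continuous_on holomorphic_on_subset)
      fix z assume "norm (x - z) = e / 4"
      then show "norm (f z) \<le> B" using sub by (intro B) (auto simp: dist_norm)
    qed (use e in auto)
    then show "norm (deriv f x) \<le> 2 * B / (e / 2)" by (simp add: field_simps)
  qed (use y e in auto)
  then show ?thesis
    using y(2) by (simp only: norm_divide pos_divide_le_eq zero_less_norm_iff right_minus_eq not_False_eq_True)
qed

text \<open>A local integrable bound on the values is enough: \<open>norm_diff_quotient_le\<close>
  turns it into a bound on the difference quotients, to which dominated convergence applies along
  sequences.\<close>

lemma holomorphic_on_lebesgue_integral:
  fixes f :: "'a \<Rightarrow> complex \<Rightarrow> complex"
  assumes "open S"
    and hol: "\<And>t. t \<in> space M \<Longrightarrow> f t holomorphic_on S"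
    and meas: "\<And>w. w \<in> S \<Longrightarrow> (\<lambda>t. f t w) \<in> borel_measurable M"
    and dom: "\<And>w. w \<in> S \<Longrightarrow> \<exists>e>0. \<exists>h. integrable M h \<and>
      (\<forall>t\<in>space M. \<forall>y\<in>ball w e \<inter> S. norm (f t y) \<le> h t)"
  shows "(\<lambda>w. \<integral>t. f t w \<partial>M) holomorphic_on S"
proof -
  have "\<exists>D. ((\<lambda>w. \<integral>t. f t w \<partial>M) has_field_derivative D) (at w)" if w: "w \<in> S" for w
  proof -
    obtain e1 h where e1: "e1 > 0" "integrable M h"
      "\<And>t y. t \<in> space M \<Longrightarrow> y \<in> ball w e1 \<inter> S \<Longrightarrow> norm (f t y) \<le> h t"
      using dom[OF w] by blast
    obtain e2 where e2: "e2 > 0" "ball w e2 \<subseteq> S"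
      using \<open>open S\<close> w by (auto simp: open_contains_ball)
    define e where "e = min e1 e2"
    have e: "e > 0" "ball w e \<subseteq> S" "\<And>t y. t \<in> space M \<Longrightarrow> y \<in> ball w e \<Longrightarrow> norm (f t y) \<le> h t"
      using e1 e2 by (auto simp: e_def subset_iff)
    have int: "integrable M (\<lambda>t. f t y)" if "y \<in> ball w e" for y
      using that e e1(2) by (intro Bochner_Integration.integrable_bound[OF e1(2)] meas AE_I2)
        (auto intro: order_trans[OF _ abs_ge_self])
    define q where "q y t = (f t y - f t w) / (y - w)" for y t
    have q_lim: "((\<lambda>y. q y t) \<longlongrightarrow> deriv (f t) w) (at w)" if "t \<in> space M" for t
      using holomorphic_derivI[OF hol[OF that] \<open>open S\<close> w]
      by (simp add: has_field_derivative_iff q_def)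
    have q_meas: "q y \<in> borel_measurable M" if "y \<in> ball w e" for y
      unfolding q_def using that e(2) w by (intro borel_measurable_divide borel_measurable_diff meas) auto
    have "((\<lambda>y. \<integral>t. q y t \<partial>M) \<longlongrightarrow> (\<integral>t. deriv (f t) w \<partial>M)) (at w within ball w (e / 2))"
      unfolding tendsto_at_iff_sequentially comp_def
    proof (intro allI impI)
      fix X assume X: "\<forall>i. X i \<in> ball w (e / 2) - {w}" "X \<longlonglongrightarrow> w"
      have lim: "(\<lambda>i. q (X i) t) \<longlonglongrightarrow> deriv (f t) w" if "t \<in> space M" for t
        using q_lim[OF that] X by (auto simp: tendsto_at_iff_sequentially comp_def)
      have Xb: "X i \<in> ball w e" for i using X(1)[rule_format, of i] e(1) by auto
      show "(\<lambda>i. \<integral>t. q (X i) t \<partial>M) \<longlonglongrightarrow> (\<integral>t. deriv (f t) w \<partial>M)"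
      proof (rule integral_dominated_convergence)
        show "(\<lambda>t. deriv (f t) w) \<in> borel_measurable M"
          by (rule borel_measurable_LIMSEQ_metric[OF q_meas[OF Xb] lim])
        show "integrable M (\<lambda>t. 2 * h t / (e / 2))" using e1(2) by simp
        show "AE t in M. norm (q (X i) t) \<le> 2 * h t / (e / 2)" for i
        proof (intro AE_I2)
          fix t assume t: "t \<in> space M"
          show "norm (q (X i) t) \<le> 2 * h t / (e / 2)"
            unfolding q_def
          proof (rule norm_diff_quotient_le)
            show "f t holomorphic_on ball w e" using hol[OF t] e(2) by (rule holomorphic_on_subset)
          qed (use X(1)[rule_format, of i] e(3)[OF t] in auto)
        qed
        show "q (X i) \<in> borel_measurable M" for i by (rule q_meas[OF Xb])
        show "AE t in M. (\<lambda>i. q (X i) t) \<longlonglongrightarrow> deriv (f t) w" using lim by (rule AE_I2)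
      qed
    qed
    then have "((\<lambda>y. \<integral>t. q y t \<partial>M) \<longlongrightarrow> (\<integral>t. deriv (f t) w \<partial>M)) (at w)"
      by (subst (asm) at_within_open) (use e(1) in auto)
    moreover have "\<forall>\<^sub>F y in at w. (\<integral>t. q y t \<partial>M) = ((\<integral>t. f t y \<partial>M) - (\<integral>t. f t w \<partial>M)) / (y - w)"
      unfolding eventually_at
    proof (intro exI[of _ e] conjI ballI impI)
      fix y assume "y \<noteq> w \<and> dist y w < e"
      then have "y \<in> ball w e" by (simp add: dist_commute)
      then show "(\<integral>t. q y t \<partial>M) = ((\<integral>t. f t y \<partial>M) - (\<integral>t. f t w \<partial>M)) / (y - w)"
        unfolding q_def using int[of y] int[of w] e(1) by simp
    qed (use e in auto)
    ultimately show ?thesis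
      by (auto simp: has_field_derivative_iff intro: Lim_transform_eventually)
  qed
  then show ?thesis
    using \<open>open S\<close> by (auto simp: holomorphic_on_open)
qed

section \<open>Integrability and scaling of Cauchy-type densities\<close>

lemma integrable_cauchy_density: "integrable lborel (\<lambda>x::real. 1 / (1 + x\<^sup>2))"
  using integrable_inverse_1_plus_square by (simp add: set_integrable_def inverse_eq_divide)

text \<open>Near 0 the power is integrable because the exponent is below 1; for |x| > 1 it is at
  most 1 and the Cauchy density dominates. The negative half of the unit interval is the reflection
  of the positive one.\<close>

lemma integrable_powr_abs_inverse:
  assumes "0 < \<beta>" "\<beta> < 1"
  shows "integrable lborel (\<lambda>x::real. \<bar>x\<bar> powr (- \<beta>) / (1 + x\<^sup>2))"
proof -
  have "(\<lambda>x::real. x powr (- \<beta>)) integrable_on {0..1}"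
    using assms by (intro integrable_on_powr_from_0) auto
  then have "set_integrable lebesgue {0..1} (\<lambda>x::real. x powr (- \<beta>))"
    by (intro nonnegative_absolutely_integrable_1) auto
  then have pos: "integrable lborel (\<lambda>x. indicator {0..1} x *\<^sub>R x powr (- \<beta>))"
    unfolding set_integrable_def by (subst (asm) integrable_completion) auto
  have neg: "integrable lborel (\<lambda>x. indicator {0..1} (-x) *\<^sub>R (-x) powr (- \<beta>))"
    using lborel_integrable_real_affine[OF pos, of "-1" 0] by simp
  show ?thesis
  proof (rule Bochner_Integration.integrable_bound)
    show "integrable lborel (\<lambda>x. indicator {0..1} x *\<^sub>R x powr (- \<beta>) + 
        indicator {0..1} (-x) *\<^sub>R (-x) powr (- \<beta>) + 1 / (1 + x\<^sup>2))"
      by (intro Bochner_Integration.integrable_add pos neg integrable_cauchy_density)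
    show "AE x in lborel. norm (\<bar>x\<bar> powr (- \<beta>) / (1 + x\<^sup>2)) \<le> norm (indicator {0..1} x *\<^sub>R x powr (- \<beta>) + 
        indicator {0..1} (-x) *\<^sub>R (-x) powr (- \<beta>) + 1 / (1 + x\<^sup>2))"
    proof (intro AE_I2)
      fix x :: real
      have pos: "1 + x\<^sup>2 > 0" "1 + x\<^sup>2 \<ge> 1" using zero_le_power2[of x] by linarith+
      show "norm (\<bar>x\<bar> powr (- \<beta>) / (1 + x\<^sup>2)) \<le> norm (indicator {0..1} x *\<^sub>R x powr (- \<beta>) + 
        indicator {0..1} (-x) *\<^sub>R (-x) powr (- \<beta>) + 1 / (1 + x\<^sup>2))" (is "_ \<le> norm ?R")
      proof (cases "\<bar>x\<bar> \<le> 1")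
        case True
        have "\<bar>x\<bar> powr (- \<beta>) / (1 + x\<^sup>2) \<le> \<bar>x\<bar> powr (- \<beta>) / 1"
          by (intro divide_left_mono) (auto intro: add_pos_nonneg)
        also have "\<dots> \<le> indicator {0..1} x *\<^sub>R x powr (- \<beta>) + indicator {0..1} (-x) *\<^sub>R (-x) powr (- \<beta>)"
          using True by (cases "x \<ge> 0") (auto simp: indicator_def)
        also have "\<dots> \<le> ?R" using pos by simp
        also have "\<dots> \<le> norm ?R" by simp
        finally show ?thesis using pos by simp
      next
        case False
        have "\<bar>x\<bar> powr (- \<beta>) \<le> 1" using False assms by (simp add: powr_minus_divide ge_one_powr_ge_zero)
        then have "\<bar>x\<bar> powr (- \<beta>) / (1 + x\<^sup>2) \<le> 1 / (1 + x\<^sup>2)"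
          using pos by (intro divide_right_mono) auto
        moreover have "?R = 1 / (1 + x\<^sup>2)" using False by (auto simp: indicator_def)
        ultimately show ?thesis using pos by simp
      qed
    qed
  qed simp
qed

text \<open>Scaling by \<open>x\<close> turns the Poisson kernel into the Cauchy density.\<close>
lemma poisson_kernel_scale:
  fixes f :: "real \<Rightarrow> real"
  assumes "x > 0" and f: "integrable lborel (\<lambda>t. f t / (1 + t\<^sup>2))"
  shows "integrable lborel (\<lambda>t. f (t / x) * (x / (x\<^sup>2 + t\<^sup>2)))"
    and "(\<integral>t. f (t / x) * (x / (x\<^sup>2 + t\<^sup>2)) \<partial>lborel) = (\<integral>t. f t / (1 + t\<^sup>2) \<partial>lborel)"
proof -
  have eq: "f (t / x) * (x / (x\<^sup>2 + t\<^sup>2)) = (f (0 + (1 / x) * t) / (1 + (0 + (1 / x) * t)\<^sup>2)) / x" for t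
  proof -
    have "x / (x\<^sup>2 + t\<^sup>2) = 1 / (1 + (t / x)\<^sup>2) / x"
      using assms(1) by (simp add: divide_simps power2_eq_square)
    then show ?thesis by simp
  qed
  show "integrable lborel (\<lambda>t. f (t / x) * (x / (x\<^sup>2 + t\<^sup>2)))"
    unfolding eq using lborel_integrable_real_affine[OF f, of "1 / x" 0] assms(1)
    by (intro integrable_divide) auto
  have "(\<integral>t. f (t / x) * (x / (x\<^sup>2 + t\<^sup>2)) \<partial>lborel) = (\<integral>t. f (0 + (1 / x) * t) / (1 + (0 + (1 / x) * t)\<^sup>2) \<partial>lborel) / x"
    unfolding eq by (rule integral_divide_zero)
  then show "(\<integral>t. f (t / x) * (x / (x\<^sup>2 + t\<^sup>2)) \<partial>lborel) = (\<integral>t. f t / (1 + t\<^sup>2) \<partial>lborel)"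
    using lborel_integral_real_affine[of "1 / x" "\<lambda>t. f t / (1 + t\<^sup>2)" 0] assms(1) by simp
qed

section \<open>Topology of strips\<close>

lemma open_strip: "open (strip d)"
  unfolding strip_def by (intro open_Collect_less continuous_intros)

lemma convex_strip: "convex (strip d)"
proof -
  have "strip d = {w. Im w < d * pi / 2} \<inter> {w. Im w > - (d * pi / 2)}"
    by (auto simp: strip_def)
  then show ?thesis
    by (simp only: convex_Int convex_halfspace_Im_lt convex_halfspace_Im_gt)
qed

lemma strip_mono: "c \<le> d \<Longrightarrow> strip c \<subseteq> strip d"
  by (auto simp: strip_def intro: less_le_trans divide_right_mono mult_right_mono)

section \<open>The outer function\<close>

context kernel
begin

text \<open>At the origin this is \<open>ln 0 = 0\<close>, so sign and lower bounds hold for every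
  t, whereas the upper bound \<open>lnh_le\<close> must exclude 0.\<close>

definition lnh :: "real \<Rightarrow> real" where
  "lnh t = ln (hM (\<lambda>p. M p powr s) \<bar>t\<bar>)"

lemma h_le: "t > 0 \<Longrightarrow> hM (\<lambda>p. M p powr s) t \<le> M q powr s * t ^ q"
  unfolding hM_def by (auto intro!: cInf_lower bdd_belowI[of _ 0])

lemma h_ge:
  assumes "t > 0" "\<And>q. c \<le> M q powr s * t ^ q"
  shows "c \<le> hM (\<lambda>p. M p powr s) t"
  using assms unfolding hM_def by (auto intro!: cInf_greatest)

lemma M_powr_eq:
  assumes "t > 0"
  shows "(M q * t ^ q) powr s = M q powr s * (t powr s) ^ q"
proof -
  have "(t ^ q) powr s = (t powr s) ^ q"
    using assms by (simp add: powr_powr mult.commute flip: powr_realpow)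
  then show ?thesis using M_pos[of q] assms by (simp add: powr_mult)
qed

definition \<beta> :: real where "\<beta> = 1 / (s * g)"

lemma \<beta>: "0 < \<beta>" "\<beta> < 1"
  using sg s_pos g_pos by (auto simp: \<beta>_def)

definition C1 :: real where "C1 = s * (2 * ln A + g * (a\<^sup>2) powr (1 / g))"

lemma C1_nonneg: "C1 \<ge> 0"
  using s_pos A_ge_1 g_pos by (auto simp: C1_def intro!: mult_nonneg_nonneg add_nonneg_nonneg)

text \<open>With r = t^(1/s) this is \<open>M_power_ge_exp\<close> raised to the power s;
  \<open>C1\<close> covers both summands of the exponent. The index p stays free: p = 0 gives
  integrability, general p the lower bounds for the moments.\<close>

lemma h_ge_exp:
  assumes "t > 0"
  shows "exp (- (C1 * (real p + 1) * (1 + (quot_seq M p powr s * t) powr (- \<beta>)))) \<le> hM (\<lambda>p. M p powr s) t"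
proof (rule h_ge[OF assms])
  fix q
  define m where "m = quot_seq M p"
  have m: "m > 0" unfolding m_def by (rule quot_pos)
  define r where "r = t powr (1 / s)"
  have r: "r > 0" "r powr s = t" using assms s_pos by (auto simp: r_def powr_powr)
  define e where "e = (m powr s * t) powr (- \<beta>)"
  have e: "e \<ge> 0" by (simp add: e_def)
  have "(m * r) powr (- 1 / g) = ((m * r) powr s) powr (- \<beta>)"
    using s_pos by (simp add: powr_powr \<beta>_def)
  also have "(m * r) powr s = m powr s * t" using r by (simp add: powr_mult)
  finally have e_eq: "(m * r) powr (- 1 / g) = e" by (simp add: e_def)
  have "C1 * (real p + 1) * (1 + e) = s * (2 * ln A * (real p + 1) * (1 + e) + g * (a\<^sup>2) powr (1 / g) * (real p + 1) * (1 + e))"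
    by (simp add: C1_def algebra_simps)
  also have "\<dots> \<ge> s * (2 * real p * ln A + g * (real p + 1) * (a\<^sup>2) powr (1 / g) * e)"
  proof -
    have "real p * 1 \<le> (real p + 1) * (1 + e)" using e by (intro mult_mono) auto
    from mult_left_mono[OF this, of "2 * ln A"] 
    have 1: "2 * real p * ln A \<le> 2 * ln A * (real p + 1) * (1 + e)" using A_ge_1 by (simp add: mult_ac)
    have "g * (real p + 1) * (a\<^sup>2) powr (1 / g) * e \<le> g * (real p + 1) * (a\<^sup>2) powr (1 / g) * (1 + e)"
      using g_pos by (intro mult_left_mono) auto
    then have 2: "g * (real p + 1) * (a\<^sup>2) powr (1 / g) * e \<le> g * (a\<^sup>2) powr (1 / g) * (real p + 1) * (1 + e)"
      by (simp only: mult_ac)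
    show ?thesis using 1 2 s_pos by (intro mult_left_mono add_mono) auto
  qed
  finally have "exp (- (C1 * (real p + 1) * (1 + e)))
      \<le> exp (- (2 * real p * ln A + g * (real p + 1) * (a\<^sup>2) powr (1 / g) * e)) powr s"
    by (simp only: powr_def exp_not_eq_zero if_False ln_exp exp_le_cancel_iff mult_minus_right neg_le_iff_le)
  also have "\<dots> \<le> (M q * r ^ q) powr s"
    using M_power_ge_exp[OF r(1), of p q] s_pos unfolding m_def[symmetric] e_eq 
    by (intro powr_mono2) auto
  also have "\<dots> = M q powr s * t ^ q"
    using M_powr_eq[OF r(1)] r(2) by simp
  finally show "exp (- (C1 * (real p + 1) * (1 + (quot_seq M p powr s * t) powr (- \<beta>)))) \<le> M q powr s * t ^ q"
    by (simp add: m_def e_def)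
qed

lemma h_pos: "t > 0 \<Longrightarrow> hM (\<lambda>p. M p powr s) t > 0"
  using h_ge_exp[of t 0] less_le_trans[OF exp_gt_zero] by blast

lemma lnh_le:
  assumes "t \<noteq> 0"
  shows "lnh t \<le> ln (M q powr s * \<bar>t\<bar> ^ q)"
  using assms h_le[of "\<bar>t\<bar>" q] h_pos[of "\<bar>t\<bar>"] unfolding lnh_def by (intro ln_mono) auto

lemma lnh_nonpos: "lnh t \<le> 0"
  using lnh_le[of t 0] by (cases "t = 0") (auto simp: lnh_def hM_def M_0)

lemma lnh_ge: "- lnh t \<le> C1 * (real p + 1) * (1 + (quot_seq M p powr s * \<bar>t\<bar>) powr (- \<beta>))"
proof (cases "t = 0")
  case True
  then show ?thesis using C1_nonneg by (simp add: lnh_def hM_def)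
next
  case False
  then have "ln (exp (- (C1 * (real p + 1) * (1 + (quot_seq M p powr s * \<bar>t\<bar>) powr (- \<beta>))))) \<le> lnh t"
    unfolding lnh_def using h_ge_exp[of "\<bar>t\<bar>" p] by (intro ln_mono) auto
  then show ?thesis by simp
qed

text \<open>An infimum of increasing functions is increasing, hence Borel. Truncation by
  \<open>max 0\<close> extends monotonicity to the whole line and disappears on inserting
  |t|.\<close>

lemma lnh_measurable [measurable]: "lnh \<in> borel_measurable borel"
proof -
  have "mono (\<lambda>t. hM (\<lambda>p. M p powr s) (max 0 t))"
  proof
    fix x y :: real assume "x \<le> y"
    show "hM (\<lambda>p. M p powr s) (max 0 x) \<le> hM (\<lambda>p. M p powr s) (max 0 y)"
    proof (cases "x > 0")
      case True
      have "hM (\<lambda>p. M p powr s) x \<le> M q powr s * y ^ q" for q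
        using h_le[OF True, of q] True \<open>x \<le> y\<close> M_pos[of q]
        by (elim order_trans) (intro mult_left_mono power_mono, auto)
      then show ?thesis using True \<open>x \<le> y\<close> by (auto simp: max_def intro: h_ge)
    next
      case False
      then show ?thesis using h_pos[of "max 0 y"] 
        by (cases "y > 0") (auto simp: hM_def[of _ 0] max_def intro: less_imp_le)
    qed
  qed
  then have [measurable]: "(\<lambda>t. hM (\<lambda>p. M p powr s) (max 0 t)) \<in> borel_measurable borel"
    by (rule borel_measurable_mono)
  have "lnh = (\<lambda>t. ln (hM (\<lambda>p. M p powr s) (max 0 \<bar>t\<bar>)))" by (simp add: lnh_def fun_eq_iff max_def)
  then show ?thesis by (simp only:) measurable
qed

lemma integrable_one_plus_powr:
  "integrable lborel (\<lambda>t. (1 + \<bar>t\<bar> powr (- \<beta>)) / (1 + t\<^sup>2))"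
  using integrable_cauchy_density integrable_powr_abs_inverse[OF \<beta>]
  unfolding add_divide_distrib by (intro Bochner_Integration.integrable_add)

lemma lnh_integrable: "integrable lborel (\<lambda>t. lnh t / (1 + t\<^sup>2))"
proof (rule Bochner_Integration.integrable_bound)
  define c where "c = (quot_seq M 0 powr s) powr (- \<beta>)"
  show "integrable lborel (\<lambda>t. C1 * (1 + c) * ((1 + \<bar>t\<bar> powr (- \<beta>)) / (1 + t\<^sup>2)))"
    by (intro integrable_mult_right integrable_one_plus_powr)
  show "AE t in lborel. norm (lnh t / (1 + t\<^sup>2)) \<le> norm (C1 * (1 + c) * ((1 + \<bar>t\<bar> powr (- \<beta>)) / (1 + t\<^sup>2)))"
  proof (rule AE_I2)
    fix t :: real
    define b where "b = \<bar>t\<bar> powr (- \<beta>)"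
    have "b \<ge> 0" "c \<ge> 0" by (auto simp: b_def c_def)
    have "norm (lnh t) \<le> C1 * (1 + c * b)"
      using lnh_ge[of t 0] lnh_nonpos[of t] quot_pos[of 0] by (simp add: powr_mult c_def b_def)
    also have "\<dots> \<le> C1 * ((1 + c) * (1 + b))"
      using C1_nonneg \<open>b \<ge> 0\<close> \<open>c \<ge> 0\<close> by (intro mult_left_mono) (auto simp: algebra_simps)
    finally have "norm (lnh t) / (1 + t\<^sup>2) \<le> C1 * (1 + c) * (1 + b) / (1 + t\<^sup>2)"
      by (intro divide_right_mono) (auto simp: mult_ac)
    also have "\<dots> \<le> norm \<dots>" unfolding real_norm_def by (rule abs_ge_self)
    finally show "norm (lnh t / (1 + t\<^sup>2)) \<le> norm (C1 * (1 + c) * ((1 + \<bar>t\<bar> powr (- \<beta>)) / (1 + t\<^sup>2)))"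
      by (simp add: b_def)
  qed
qed simp

section \<open>The Herglotz kernel of the right half plane and holomorphy of G\<close>

definition herglotz :: "complex \<Rightarrow> real \<Rightarrow> complex" where
  "herglotz z t = (\<i> * complex_of_real t * z - 1) / (\<i> * complex_of_real t - z)"

lemma it_minus_nonzero: "Re z > 0 \<Longrightarrow> \<i> * complex_of_real t - z \<noteq> 0"
  by (auto simp: complex_eq_iff)

text \<open>Writing the kernel as z + (z^2 - 1) / (i t - z) shows that it is bounded uniformly in
  t.\<close>

lemma norm_herglotz_le:
  assumes "Re z > 0"
  shows "norm (herglotz z t) \<le> norm z + ((norm z)\<^sup>2 + 1) / Re z"
proof -
  have nz: "\<i> * complex_of_real t - z \<noteq> 0" using it_minus_nonzero[OF assms] .
  have "herglotz z t = z + (z\<^sup>2 - 1) / (\<i> * complex_of_real t - z)"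
    unfolding herglotz_def using nz by (simp add: field_simps power2_eq_square)
  also have "norm \<dots> \<le> norm z + norm (z\<^sup>2 - 1) / norm (\<i> * complex_of_real t - z)"
    by (metis norm_triangle_ineq norm_divide)
  also have "norm (z\<^sup>2 - 1) / norm (\<i> * complex_of_real t - z) \<le> ((norm z)\<^sup>2 + 1) / Re z"
  proof (rule frac_le)
    show "norm (z\<^sup>2 - 1) \<le> (norm z)\<^sup>2 + 1"
      using norm_triangle_ineq4[of "z\<^sup>2" 1] by (simp add: norm_power)
    show "Re z \<le> norm (\<i> * complex_of_real t - z)"
      using abs_Re_le_cmod[of "\<i> * complex_of_real t - z"] assms by simp
  qed (use assms in auto)
  finally show ?thesis by simp
qed

text \<open>Up to the factor pi the right-hand side is the Poisson kernel of the right half plane;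
  this is what makes |G| the exponential of a Poisson integral.\<close>

lemma Re_herglotz:
  assumes "Re z > 0"
  shows "Re (herglotz z t) / (1 + t\<^sup>2) = Re z / (norm (\<i> * complex_of_real t - z))\<^sup>2"
proof -
  define x y where "x = Re z" and "y = Im z"
  have D: "(norm (\<i> * complex_of_real t - z))\<^sup>2 = x\<^sup>2 + (t - y)\<^sup>2"
    by (simp add: cmod_power2 x_def y_def)
  have "x\<^sup>2 + (t - y)\<^sup>2 > 0" using assms by (auto simp: x_def intro: add_pos_nonneg)
  moreover have "1 + t\<^sup>2 > 0" by (simp add: add_pos_nonneg)
  moreover have "Re (herglotz z t) = (x * (1 + t\<^sup>2)) / (x\<^sup>2 + (t - y)\<^sup>2)"
    unfolding herglotz_def by (simp add: Re_divide x_def[symmetric] y_def[symmetric])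
      (simp add: power2_eq_square algebra_simps)
  ultimately show ?thesis unfolding D by (simp add: x_def)
qed

text \<open>The infimum of the cosine of arg (z^s) over the sector of opening \<open>d\<close>,
  positive because \<open>s * d < 1\<close>.\<close>

definition \<kappa> :: real where "\<kappa> = cos (s * d * pi / 2)"

lemma \<kappa>_pos: "\<kappa> > 0"
  unfolding \<kappa>_def using sd s_pos d_pos pi_gt_zero
  by (intro cos_gt_zero_pi) (auto intro: less_le_trans[of _ 0])

definition zeta :: "complex \<Rightarrow> complex" where "zeta v = exp (complex_of_real s * v)"

lemma norm_zeta: "norm (zeta v) = exp (Re v) powr s"
  by (simp add: zeta_def powr_def mult.commute)

lemma Re_zeta_ge:
  assumes "v \<in> strip d"
  shows "Re (zeta v) \<ge> norm (zeta v) * \<kappa>"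
proof -
  have v: "\<bar>Im v\<bar> \<le> d * pi / 2" using assms by (auto simp: strip_def)
  have le: "\<bar>s * Im v\<bar> \<le> s * d * pi / 2"
    using mult_left_mono[OF v, of s] s_pos by (simp add: abs_mult)
  have "s * d * pi / 2 \<le> 1 * pi / 2"
    using sd by (intro divide_right_mono mult_right_mono) auto
  then have "\<kappa> \<le> cos \<bar>s * Im v\<bar>"
    unfolding \<kappa>_def using le pi_gt_zero by (intro cos_monotone_0_pi_le) linarith+
  then have "\<kappa> \<le> cos (s * Im v)" by (simp only: cos_abs_real)
  then show ?thesis by (simp add: zeta_def Re_exp)
qed

lemma norm_zeta_pos: "norm (zeta v) > 0"
  by (simp add: zeta_def)

lemma Re_zeta_pos: "v \<in> strip d \<Longrightarrow> Re (zeta v) > 0"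
  using Re_zeta_ge[of v] mult_pos_pos[OF norm_zeta_pos \<kappa>_pos, of v] by linarith

definition integrand :: "real \<Rightarrow> complex \<Rightarrow> complex" where
  "integrand t v = complex_of_real (lnh t) * herglotz (zeta v) t / complex_of_real (1 + t\<^sup>2)"

lemma Glog_eq: "Glog M s v = exp (complex_of_real (1 / pi) * (\<integral>t. integrand t v \<partial>lborel))"
  by (simp add: Glog_def integrand_def lnh_def herglotz_def zeta_def)

lemma integrand_measurable [measurable]: "(\<lambda>t. integrand t v) \<in> borel_measurable borel"
  unfolding integrand_def herglotz_def by measurable

lemma norm_integrand_le:
  assumes "norm (herglotz (zeta v) t) \<le> B"
  shows "norm (integrand t v) \<le> B * norm (lnh t / (1 + t\<^sup>2))"
proof -
  have "norm (integrand t v) = norm (herglotz (zeta v) t) * norm (lnh t / (1 + t\<^sup>2))"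
    by (simp add: integrand_def norm_mult norm_divide del: of_real_add)
  also have "\<dots> \<le> B * norm (lnh t / (1 + t\<^sup>2))" using assms by (intro mult_right_mono) auto
  finally show ?thesis .
qed

lemma integrand_integrable:
  assumes "v \<in> strip d"
  shows "integrable lborel (\<lambda>t. integrand t v)"
proof (rule Bochner_Integration.integrable_bound)
  define B where "B = norm (zeta v) + ((norm (zeta v))\<^sup>2 + 1) / Re (zeta v)"
  show "integrable lborel (\<lambda>t. B * norm (lnh t / (1 + t\<^sup>2)))"
    using lnh_integrable by (intro integrable_mult_right integrable_norm)
  show "AE t in lborel. norm (integrand t v) \<le> norm (B * norm (lnh t / (1 + t\<^sup>2)))"
  proof (rule AE_I2)
    fix t
    have "norm (integrand t v) \<le> B * norm (lnh t / (1 + t\<^sup>2))"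
      unfolding B_def by (intro norm_integrand_le norm_herglotz_le Re_zeta_pos assms)
    also have "\<dots> \<le> norm \<dots>" unfolding real_norm_def by (rule abs_ge_self)
    finally show "norm (integrand t v) \<le> norm (B * norm (lnh t / (1 + t\<^sup>2)))" .
  qed
qed simp

lemma Glog_holomorphic: "Glog M s holomorphic_on strip d"
proof -
  have "(\<lambda>v. \<integral>t. integrand t v \<partial>lborel) holomorphic_on strip d"
  proof (rule holomorphic_on_lebesgue_integral[OF open_strip])
    show "integrand t holomorphic_on strip d" for t
      unfolding integrand_def herglotz_def zeta_def
      using it_minus_nonzero[OF Re_zeta_pos, unfolded zeta_def]
      by (intro holomorphic_intros) (auto simp del: of_real_add simp: add_nonneg_eq_0_iff)
    fix v assume v: "v \<in> strip d"
    \<comment> \<open>On the unit disc about v, inside the strip, R bounds |zeta| from above and r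
      bounds Re zeta from below, so \<open>norm_herglotz_le\<close> becomes uniform there.\<close>
    define R where "R = exp (Re v + 1) powr s"
    define r where "r = exp (Re v - 1) powr s * \<kappa>"
    have r: "r > 0" using \<kappa>_pos by (simp add: r_def)
    have "norm (integrand t y) \<le> (R + (R\<^sup>2 + 1) / r) * norm (lnh t / (1 + t\<^sup>2))"
      if y: "y \<in> ball v 1 \<inter> strip d" for t y
    proof (rule norm_integrand_le)
      have "\<bar>Re y - Re v\<bar> \<le> 1"
        using y abs_Re_le_cmod[of "y - v"] by (auto simp: dist_norm norm_minus_commute)
      then have "Re y \<le> Re v + 1" "Re v - 1 \<le> Re y" by linarith+
      then have 1: "norm (zeta y) \<le> R" "exp (Re v - 1) powr s \<le> norm (zeta y)"
        unfolding norm_zeta R_def using s_pos by (auto intro!: powr_mono2)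
      have 2: "r \<le> Re (zeta y)" 
        unfolding r_def using y \<kappa>_pos
        by (intro order_trans[OF mult_right_mono[OF 1(2)] Re_zeta_ge]) auto
      have "norm (herglotz (zeta y) t) \<le> norm (zeta y) + ((norm (zeta y))\<^sup>2 + 1) / Re (zeta y)"
        using r 2 by (intro norm_herglotz_le) auto
      also have "\<dots> \<le> R + (R\<^sup>2 + 1) / r"
        using 1 2 r by (intro add_mono frac_le power_mono) auto
      finally show "norm (herglotz (zeta y) t) \<le> R + (R\<^sup>2 + 1) / r" .
    qed
    then show "\<exists>e>0. \<exists>h. integrable lborel h \<and> (\<forall>t\<in>space lborel. \<forall>y\<in>ball v e \<inter> strip d. norm (integrand t y) \<le> h t)"
      using lnh_integrable by (intro exI[of _ 1] conjI exI[of _ "\<lambda>t. (R + (R\<^sup>2 + 1) / r) * norm (lnh t / (1 + t\<^sup>2))"]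
        integrable_mult_right integrable_norm) auto
  qed simp
  then show ?thesis
    unfolding Glog_eq[abs_def] by (intro holomorphic_intros)
qed

section \<open>The Poisson integral for |G| and upper bounds\<close>

definition poisson :: "complex \<Rightarrow> real \<Rightarrow> real" where
  "poisson z t = Re z / (norm (\<i> * complex_of_real t - z))\<^sup>2"

lemma Re_integrand:
  assumes "v \<in> strip d"
  shows "Re (integrand t v) = lnh t * poisson (zeta v) t"
proof -
  have "Re (integrand t v) = lnh t * (Re (herglotz (zeta v) t) / (1 + t\<^sup>2))"
    unfolding integrand_def by (simp add: Re_divide_of_real del: of_real_add)
  then show ?thesis using Re_herglotz[OF Re_zeta_pos[OF assms]] by (simp add: poisson_def)
qed

lemma
  assumes "v \<in> strip d"
  shows lnh_poisson_integrable: "integrable lborel (\<lambda>t. lnh t * poisson (zeta v) t)"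
    and norm_Glog: "norm (Glog M s v) = exp ((\<integral>t. lnh t * poisson (zeta v) t \<partial>lborel) / pi)"
proof -
  show "integrable lborel (\<lambda>t. lnh t * poisson (zeta v) t)"
    using integrable_Re[OF integrand_integrable[OF assms]] by (simp only: Re_integrand[OF assms])
  have "Re (\<integral>t. integrand t v \<partial>lborel) = (\<integral>t. lnh t * poisson (zeta v) t \<partial>lborel)"
    by (simp only: integral_Re[OF integrand_integrable[OF assms], symmetric] Re_integrand[OF assms])
  then show "norm (Glog M s v) = exp ((\<integral>t. lnh t * poisson (zeta v) t \<partial>lborel) / pi)"
    by (simp add: Glog_eq)
qed

lemma poisson_nonneg: "v \<in> strip d \<Longrightarrow> poisson (zeta v) t \<ge> 0"
  using Re_zeta_pos[of v] by (simp add: poisson_def)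

lemma norm_Glog_le_1: "v \<in> strip d \<Longrightarrow> norm (Glog M s v) \<le> 1"
  using lnh_nonpos poisson_nonneg
    Bochner_Integration.integral_nonneg[of lborel "\<lambda>t. - (lnh t * poisson (zeta v) t)"]
  by (simp add: norm_Glog divide_nonpos_pos mult_nonpos_nonneg)

text \<open>For |t| at most \<rho> = |zeta| the Poisson kernel is at least \<kappa> / (4 \<rho>),
  and this range of t has length 2 \<rho>; with the factor 1/pi this produces the exponent. The
  assumption \<open>less\<close> makes ln x negative, so smaller kernel values give an upper
  bound.\<close>

lemma norm_Glog_le_powr:
  assumes v: "v \<in> strip d" and less: "M q * exp (Re v) ^ q < 1"
  shows "norm (Glog M s v) \<le> (M q * exp (Re v) ^ q) powr (s * \<kappa> / (2 * pi))"
proof -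
  define \<rho> where "\<rho> = norm (zeta v)"
  define x where "x = M q * exp (Re v) ^ q"
  have x: "x > 0" "x < 1" using less M_pos[of q] by (auto simp: x_def)
  have x_powr: "x powr s = M q powr s * \<rho> ^ q"
    unfolding x_def \<rho>_def norm_zeta by (rule M_powr_eq) simp
  have \<rho>: "\<rho> > 0" unfolding \<rho>_def by (rule norm_zeta_pos)
  have "(\<integral>t. lnh t * poisson (zeta v) t \<partial>lborel) \<le> (\<integral>t. indicator {-\<rho>..\<rho>} t * (s * ln x * (\<kappa> / (4 * \<rho>))) \<partial>lborel)"
  proof (rule integral_mono_AE[OF lnh_poisson_integrable[OF v]])
    \<comment> \<open>The inequality fails at t = 0, where \<open>lnh\<close> is 0 by convention and
      the right-hand side is negative; the origin is discarded as a null set.\<close>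
    show "AE t in lborel. lnh t * poisson (zeta v) t \<le> indicator {-\<rho>..\<rho>} t * (s * ln x * (\<kappa> / (4 * \<rho>)))"
      using AE_lborel_singleton[of "0::real"]
    proof eventually_elim
      fix t :: real assume "t \<noteq> 0"
      show "lnh t * poisson (zeta v) t \<le> indicator {-\<rho>..\<rho>} t * (s * ln x * (\<kappa> / (4 * \<rho>)))"
      proof (cases "\<bar>t\<bar> \<le> \<rho>")
        case True
        have "lnh t \<le> ln (M q powr s * \<bar>t\<bar> ^ q)" by (rule lnh_le[OF \<open>t \<noteq> 0\<close>])
        also have "\<dots> \<le> ln (x powr s)"
          unfolding x_powr using True \<open>t \<noteq> 0\<close> M_pos[of q] by (intro ln_mono mult_left_mono power_mono) auto
        finally have 1: "lnh t \<le> s * ln x" using x by (simp add: ln_powr)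
        have "norm (\<i> * complex_of_real t - zeta v) \<le> 2 * \<rho>"
          using norm_triangle_ineq4[of "\<i> * complex_of_real t" "zeta v"] True by (simp add: norm_mult \<rho>_def)
        then have "(norm (\<i> * complex_of_real t - zeta v))\<^sup>2 \<le> (2 * \<rho>)\<^sup>2" by (intro power_mono) auto
        then have "\<rho> * \<kappa> / (2 * \<rho>)\<^sup>2 \<le> poisson (zeta v) t"
          unfolding poisson_def using Re_zeta_ge[OF v] it_minus_nonzero[OF Re_zeta_pos[OF v], of t] Re_zeta_pos[OF v]
          by (intro frac_le) (auto simp: \<rho>_def)
        then have 2: "\<kappa> / (4 * \<rho>) \<le> poisson (zeta v) t"
          using \<rho> by (simp add: power2_eq_square field_simps)
        have "lnh t * poisson (zeta v) t \<le> s * ln x * poisson (zeta v) t"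
          using 1 poisson_nonneg[OF v] by (intro mult_right_mono) auto
        also have "\<dots> \<le> s * ln x * (\<kappa> / (4 * \<rho>))"
          using 2 x s_pos by (intro mult_left_mono_neg) (auto simp: mult_le_0_iff)
        finally show ?thesis using True by (simp add: indicator_def abs_le_iff)
      next
        case False
        then show ?thesis using lnh_nonpos[of t] poisson_nonneg[OF v, of t] by (auto simp: indicator_def mult_le_0_iff)
      qed
    qed
  qed (use \<rho> in \<open>auto intro!: integrable_mult_left integrable_real_indicator\<close>)
  also have "\<dots> = s * ln x * \<kappa> / 2"
    using \<rho> by (simp add: field_simps)
  finally have "norm (Glog M s v) \<le> exp (s * ln x * \<kappa> / 2 / pi)"
    unfolding norm_Glog[OF v] exp_le_cancel_iff by (rule divide_right_mono) simp
  also have "\<dots> = x powr (s * \<kappa> / (2 * pi))" using x by (simp add: powr_def mult_ac)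
  finally show ?thesis by (simp add: x_def)
qed

text \<open>Chosen so that 1 / n0 does not exceed the exponent in
  \<open>norm_Glog_le_powr\<close>.\<close>

definition n0 :: nat where "n0 = nat \<lceil>2 * pi / (s * \<kappa>)\<rceil>"

lemma n0: "n0 > 0" "1 / real n0 \<le> s * \<kappa> / (2 * pi)"
proof -
  have pos: "2 * pi / (s * \<kappa>) > 0" using s_pos \<kappa>_pos by simp
  have "2 * pi / (s * \<kappa>) \<le> real n0" unfolding n0_def by linarith
  moreover from this pos have "real n0 > 0" by linarith
  ultimately show "n0 > 0" "1 / real n0 \<le> s * \<kappa> / (2 * pi)"
    using s_pos \<kappa>_pos by (auto simp: field_simps)
qed

definition K0 :: real where "K0 = A ^ n0"

lemma K0_ge_1: "K0 \<ge> 1"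
  using A_ge_1 by (simp add: K0_def)

text \<open>If the right-hand side y is at least 1, then |G| <= 1 suffices. Otherwise use
  \<open>norm_Glog_le_powr\<close> at order \<open>n0 * q\<close>: its base x is at most y^n0 by
  \<open>moderate_mult\<close>, and since x < 1 the exponent may be lowered to 1 / n0, which returns
  y.\<close>

lemma norm_Glog_le:
  assumes v: "v \<in> strip d"
  shows "norm (Glog M s v) \<le> K0 ^ q * M q * exp (Re v) ^ q"
proof (cases "K0 ^ q * M q * exp (Re v) ^ q \<ge> 1")
  case True
  then show ?thesis using norm_Glog_le_1[OF v] by linarith
next
  case False
  define y where "y = K0 ^ q * M q * exp (Re v) ^ q"
  have y: "y > 0" "y < 1" using False K0_ge_1 M_pos[of q] by (auto simp: y_def)
  define x where "x = M (n0 * q) * exp (Re v) ^ (n0 * q)"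
  have x: "x > 0" using M_pos by (simp add: x_def)
  have "x \<le> (A ^ (n0 * n0 * q) * M q ^ n0) * exp (Re v) ^ (n0 * q)"
    unfolding x_def by (intro mult_right_mono moderate_mult) auto
  also have "\<dots> = y ^ n0"
    by (simp add: y_def K0_def power_mult_distrib mult_ac flip: power_mult)
  finally have xy: "x \<le> y ^ n0" .
  also have "y ^ n0 < 1" using y n0(1) by (simp add: power_less_one_iff)
  finally have "x < 1" .
  then have "norm (Glog M s v) \<le> x powr (s * \<kappa> / (2 * pi))"
    unfolding x_def by (intro norm_Glog_le_powr v)
  also have "\<dots> \<le> x powr (1 / real n0)"
    using x \<open>x < 1\<close> n0(2) by (intro powr_mono') auto
  also have "\<dots> \<le> (y ^ n0) powr (1 / real n0)"
    using x xy by (intro powr_mono2) auto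
  also have "\<dots> = y" using y n0(1) by (simp add: powr_powr flip: powr_realpow)
  finally show ?thesis by (simp add: y_def)
qed

section \<open>Positivity and lower bounds of G on the real axis\<close>

lemma of_real_strip: "complex_of_real x \<in> strip d"
  using d_pos by (simp add: strip_def)

text \<open>For real x the value of \<open>zeta\<close> is real and \<open>lnh\<close> is even, so t
  to -t conjugates the integrand. The integral is therefore real and its exponential
  positive.\<close>

lemma Glog_of_real: "Glog M s (complex_of_real x) = complex_of_real (norm (Glog M s (complex_of_real x)))"
proof -
  define I where "I = (\<integral>t. integrand t (complex_of_real x) \<partial>lborel)"
  have "I = (\<integral>t. integrand (-t) (complex_of_real x) \<partial>lborel)"
    unfolding I_def using lborel_integral_real_affine[of "-1" "\<lambda>t. integrand t (complex_of_real x)" 0] by simp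
  also have "\<dots> = (\<integral>t. cnj (integrand t (complex_of_real x)) \<partial>lborel)"
  proof (rule Bochner_Integration.integral_cong[OF refl])
    fix t
    have "zeta (complex_of_real x) = complex_of_real (exp (s * x))" 
      by (simp add: zeta_def exp_of_real[symmetric])
    moreover have "(- (\<i> * complex_of_real t * y) - 1) / (- (\<i> * complex_of_real t) - y)
      = cnj ((\<i> * complex_of_real t * y - 1) / (\<i> * complex_of_real t - y))" if "cnj y = y" for y
      using that by simp
    ultimately show "integrand (-t) (complex_of_real x) = cnj (integrand t (complex_of_real x))"
      by (simp add: integrand_def herglotz_def lnh_def)
  qed
  also have "\<dots> = cnj I" unfolding I_def by (rule Bochner_Integration.integral_cnj)
  finally have "I = complex_of_real (Re I)" by (simp add: complex_eq_iff)
  then have "Glog M s (complex_of_real x) = complex_of_real (exp (Re I / pi))"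
    unfolding Glog_eq I_def[symmetric] by (metis exp_of_real mult.commute of_real_mult times_divide_eq_right mult.right_neutral)
  then show ?thesis by simp
qed

definition C2 :: real where
  "C2 = C1 * (\<integral>t. (1 + \<bar>t\<bar> powr (- \<beta>)) / (1 + t\<^sup>2) \<partial>lborel) / pi"

text \<open>The assumption says that m_p^s z is at least 1 for z = exp (s x), so m_p^s |t| in
  \<open>lnh_ge\<close> may be replaced by |t / z|. Scaling by z then makes the Poisson integral
  independent of x, leaving only the factor p + 1.\<close>

lemma norm_Glog_real_ge:
  assumes x: "x \<ge> - ln (quot_seq M p)"
  shows "exp (- C2 * (real p + 1)) \<le> norm (Glog M s (complex_of_real x))"
proof -
  define z where "z = exp (s * x)"
  have z: "z > 0" by (simp add: z_def)
  have zeta: "zeta (complex_of_real x) = complex_of_real z"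
    by (simp add: zeta_def z_def exp_of_real[symmetric])
  have P: "poisson (zeta (complex_of_real x)) t = z / (z\<^sup>2 + t\<^sup>2)" for t
    unfolding poisson_def zeta by (simp add: cmod_power2)
  have mz: "quot_seq M p powr s * z \<ge> 1"
  proof -
    have "quot_seq M p powr s * z = exp (s * (ln (quot_seq M p) + x))"
      using quot_pos[of p] by (simp add: powr_def z_def exp_add algebra_simps)
    then show ?thesis using x s_pos by simp
  qed
  define f :: "real \<Rightarrow> real" where "f t = 1 + \<bar>t\<bar> powr (- \<beta>)" for t
  note scale = poisson_kernel_scale[OF z, of f, unfolded f_def, OF integrable_one_plus_powr, folded f_def]
  have "(\<integral>t. - (lnh t * (z / (z\<^sup>2 + t\<^sup>2))) \<partial>lborel) \<le> (\<integral>t. C1 * (real p + 1) * (f (t / z) * (z / (z\<^sup>2 + t\<^sup>2))) \<partial>lborel)"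
  proof (rule integral_mono)
    show "integrable lborel (\<lambda>t. - (lnh t * (z / (z\<^sup>2 + t\<^sup>2))))"
      using lnh_poisson_integrable[OF of_real_strip, of x] unfolding P by simp
    show "integrable lborel (\<lambda>t. C1 * (real p + 1) * (f (t / z) * (z / (z\<^sup>2 + t\<^sup>2))))"
      by (intro integrable_mult_right scale)
    fix t :: real
    have "quot_seq M p powr s * \<bar>t\<bar> = (quot_seq M p powr s * z) * \<bar>t / z\<bar>" using z by (simp add: abs_divide)
    then have "(quot_seq M p powr s * \<bar>t\<bar>) powr (- \<beta>) = (quot_seq M p powr s * z) powr (- \<beta>) * \<bar>t / z\<bar> powr (- \<beta>)"
      using z by (simp only: powr_mult)
    also have "\<dots> \<le> 1 * \<bar>t / z\<bar> powr (- \<beta>)"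
    proof (rule mult_right_mono)
      have "1 \<le> (quot_seq M p powr s * z) powr \<beta>" using mz \<beta> by (intro ge_one_powr_ge_zero) auto
      then show "(quot_seq M p powr s * z) powr (- \<beta>) \<le> 1" unfolding powr_minus_divide by (intro divide_le_eq_1_pos[THEN iffD2]) linarith+
    qed simp
    finally have "- lnh t \<le> C1 * (real p + 1) * f (t / z)"
      unfolding f_def using C1_nonneg by (intro order_trans[OF lnh_ge[of t p]] mult_left_mono add_left_mono) auto
    then have "- lnh t * (z / (z\<^sup>2 + t\<^sup>2)) \<le> C1 * (real p + 1) * f (t / z) * (z / (z\<^sup>2 + t\<^sup>2))"
      using z by (intro mult_right_mono) auto
    then show "- (lnh t * (z / (z\<^sup>2 + t\<^sup>2))) \<le> C1 * (real p + 1) * (f (t / z) * (z / (z\<^sup>2 + t\<^sup>2)))"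
      by (simp only: mult_minus_left mult.assoc)
  qed
  also have "\<dots> = C1 * (real p + 1) * (\<integral>t. f t / (1 + t\<^sup>2) \<partial>lborel)"
    unfolding scale(2)[symmetric] by (rule integral_mult_right_zero)
  finally have "- (\<integral>t. lnh t * (z / (z\<^sup>2 + t\<^sup>2)) \<partial>lborel) \<le> C1 * (real p + 1) * (\<integral>t. f t / (1 + t\<^sup>2) \<partial>lborel)"
    by simp
  from divide_right_mono[OF this, of pi]
  have "- ((\<integral>t. lnh t * (z / (z\<^sup>2 + t\<^sup>2)) \<partial>lborel) / pi) \<le> C1 * (real p + 1) * (\<integral>t. f t / (1 + t\<^sup>2) \<partial>lborel) / pi"
    by (simp only: minus_divide_left pi_ge_zero)
  also have "\<dots> = C2 * (real p + 1)" by (simp add: C2_def f_def)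
  finally show ?thesis
    unfolding norm_Glog[OF of_real_strip] P by simp
qed

end

section \<open>The kernel and its moments\<close>

context kernel
begin

text \<open>In the variable \<open>u\<close>, \<open>E w u\<close> is \<open>e(u / z) / u\<close> with \<open>z = exp w\<close>.\<close>
definition E :: "complex \<Rightarrow> real \<Rightarrow> complex" where
  "E w u = exp (- w) * Glog M s (w - complex_of_real (ln u))"

lemma elog_eq: "u > 0 \<Longrightarrow> elog M s (complex_of_real (ln u) - w) = complex_of_real u * E w u"
  by (simp add: elog_def E_def exp_diff exp_minus exp_of_real field_simps)

definition D1 :: real where "D1 = K0 * A"
text \<open>The factor 2 compares 1 / r, or r / u^2, with the density r / (r^2 + u^2);
  \<open>D1\<^sup>2 * M 2\<close> pays for raising the order by two when u > r.\<close>

definition K1 :: real where "K1 = 2 * (1 + D1\<^sup>2 * M 2)"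

lemma D1_ge_1: "D1 \<ge> 1"
  using mult_mono[of 1 K0 1 A] K0_ge_1 A_ge_1 by (simp add: D1_def)

lemma K1_pos: "K1 > 0"
  using M_pos[of 2] by (simp add: K1_def add_pos_nonneg)

text \<open>The two cases of the proof use the estimate of \<open>Glog\<close> of order \<open>n\<close> for \<open>u \<le> |z|\<close> and of order \<open>n + 2\<close>
  for \<open>u > |z|\<close>; the latter provides the decay that makes the bound integrable.\<close>
lemma norm_E_le:
  assumes w: "w \<in> strip d" and u: "u > 0"
  shows "u ^ n * norm (E w u) \<le> K1 * D1 ^ n * M n * exp (Re w) ^ n * (exp (Re w) / ((exp (Re w))\<^sup>2 + u\<^sup>2))"
proof -
  define r where "r = exp (Re w)"
  have r: "r > 0" by (simp add: r_def)
  have G: "norm (Glog M s (w - complex_of_real (ln u))) \<le> K0 ^ q * M q * (r / u) ^ q" for q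
  proof -
    have "w - complex_of_real (ln u) \<in> strip d" using w by (simp add: strip_def)
    from norm_Glog_le[OF this, of q] show ?thesis
      using u by (simp add: r_def exp_diff)
  qed
  have E: "norm (E w u) = norm (Glog M s (w - complex_of_real (ln u))) / r"
    by (simp add: E_def norm_mult r_def exp_minus norm_inverse divide_inverse)
  define P where "P = D1 ^ n * M n * r ^ n"
  have P: "P > 0" using D1_ge_1 M_pos[of n] r by (simp add: P_def)
  have sq: "r\<^sup>2 + u\<^sup>2 > 0" using r by (simp add: add_pos_nonneg)
  have "u ^ n * norm (E w u) \<le> K1 * P * (r / (r\<^sup>2 + u\<^sup>2))"
  proof (cases "u \<le> r")
    case True
    have "u ^ n * norm (E w u) \<le> u ^ n * (K0 ^ n * M n * (r / u) ^ n / r)"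
      unfolding E using u r G[of n] by (intro mult_left_mono divide_right_mono) auto
    also have "\<dots> = K0 ^ n * M n * r ^ n * (1 / r)" using u by (simp add: power_divide)
    also have "\<dots> \<le> P * (2 * r / (r\<^sup>2 + u\<^sup>2))"
    proof (rule mult_mono)
      show "K0 ^ n * M n * r ^ n \<le> P"
        unfolding P_def D1_def using K0_ge_1 A_ge_1 M_pos[of n] r
        by (intro mult_right_mono power_mono) (auto simp: mult_le_cancel_left1)
      have "u\<^sup>2 \<le> r\<^sup>2" using True u by (intro power_mono) auto
      then show "1 / r \<le> 2 * r / (r\<^sup>2 + u\<^sup>2)"
        using r sq by (simp add: divide_simps power2_eq_square)
    qed (use P r in auto)
    also have "\<dots> = 2 * (P * (r / (r\<^sup>2 + u\<^sup>2)))" by simp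
    also have "\<dots> \<le> K1 * (P * (r / (r\<^sup>2 + u\<^sup>2)))"
      using P r sq M_pos[of 2] by (intro mult_right_mono) (auto simp: K1_def)
    finally show ?thesis by (simp only: mult.assoc)
  next
    case False
    have "u ^ n * norm (E w u) \<le> u ^ n * (K0 ^ (n + 2) * M (n + 2) * (r / u) ^ (n + 2) / r)"
      unfolding E using u r G[of "n + 2"] by (intro mult_left_mono divide_right_mono) auto
    also have "\<dots> = K0 ^ (n + 2) * M (n + 2) * r ^ n * (r / u\<^sup>2)"
      using u r by (simp add: power_divide power_add power2_eq_square)
    also have "\<dots> \<le> P * (D1\<^sup>2 * M 2) * (2 * r / (r\<^sup>2 + u\<^sup>2))"
    proof (rule mult_mono)
      have "K0 ^ (n + 2) * M (n + 2) * r ^ n \<le> K0 ^ (n + 2) * (A ^ (n + 2) * M n * M 2) * r ^ n"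
        using K0_ge_1 r by (intro mult_right_mono mult_left_mono moderate) auto
      also have "\<dots> = P * (D1\<^sup>2 * M 2)"
        by (simp add: P_def D1_def power_mult_distrib power_add power2_eq_square)
      finally show "K0 ^ (n + 2) * M (n + 2) * r ^ n \<le> P * (D1\<^sup>2 * M 2)" .
      have "r\<^sup>2 \<le> u\<^sup>2" using False r by (intro power_mono) auto
      then show "r / u\<^sup>2 \<le> 2 * r / (r\<^sup>2 + u\<^sup>2)"
        using r sq u by (simp add: divide_simps) 
    qed (use P M_pos[of 2] r in auto)
    also have "\<dots> = (2 * (D1\<^sup>2 * M 2)) * (P * (r / (r\<^sup>2 + u\<^sup>2)))" by simp
    also have "\<dots> \<le> K1 * (P * (r / (r\<^sup>2 + u\<^sup>2)))"
      using P r sq M_pos[of 2] by (intro mult_right_mono) (auto simp: K1_def)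
    finally show ?thesis by (simp only: mult.assoc)
  qed
  then show ?thesis by (simp add: P_def r_def mult.assoc)
qed

lemma E_measurable:
  assumes "w \<in> strip d"
  shows "(\<lambda>u. indicator {0<..} u *\<^sub>R E w u) \<in> borel_measurable borel"
proof (rule borel_measurable_continuous_on_indicator)
  have "continuous_on {0<..} (\<lambda>u. Glog M s (w - complex_of_real (ln u)))"
  proof (rule continuous_on_compose2[OF holomorphic_on_imp_continuous_on[OF Glog_holomorphic]])
    show "continuous_on {0<..} (\<lambda>u. w - complex_of_real (ln u))"
      by (intro continuous_intros) auto
    show "(\<lambda>u. w - complex_of_real (ln u)) ` {0<..} \<subseteq> strip d"
      using assms by (auto simp: strip_def)
  qed
  then show "continuous_on {0<..} (\<lambda>u. E w u)"
    unfolding E_def by (intro continuous_intros)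
qed simp

section \<open>The integral transform with the kernel\<close>

definition kernel_transform :: "(real \<Rightarrow> complex) \<Rightarrow> complex \<Rightarrow> complex" where
  "kernel_transform f w = (LINT u:{0<..}|lborel. f u * E w u)"

lemma poisson_integrable:
  assumes "r > 0"
  shows "integrable lborel (\<lambda>u::real. r / (r\<^sup>2 + u\<^sup>2))"
  using poisson_kernel_scale(1)[OF assms, of "\<lambda>_. 1"] integrable_cauchy_density by simp

definition K2 :: real where "K2 = K1 * (\<integral>u. 1 / (1 + u\<^sup>2) \<partial>lborel)"

lemma K2_nonneg: "K2 \<ge> 0"
  unfolding K2_def using K1_pos by (intro mult_nonneg_nonneg Bochner_Integration.integral_nonneg) auto

context
  fixes f :: "real \<Rightarrow> complex" and C :: real and n :: nat
  assumes f_meas [measurable]: "f \<in> borel_measurable borel"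
    and f_bound: "\<And>u. u > 0 \<Longrightarrow> norm (f u) \<le> C * u ^ n"
begin

lemma C_nonneg: "C \<ge> 0"
  using order_trans[OF norm_ge_zero f_bound[of 1]] by simp

lemma norm_mult_E_le:
  assumes w: "w \<in> strip d"
  shows "norm (indicator {0<..} u *\<^sub>R (f u * E w u))
    \<le> C * K1 * D1 ^ n * M n * exp (Re w) ^ n * (exp (Re w) / ((exp (Re w))\<^sup>2 + u\<^sup>2))"
proof (cases "u > 0")
  case True
  then have "norm (indicator {0<..} u *\<^sub>R (f u * E w u)) = norm (f u) * norm (E w u)"
    by (simp add: norm_mult)
  also have "\<dots> \<le> C * u ^ n * norm (E w u)" using f_bound[OF True] by (intro mult_right_mono) auto
  also have "\<dots> = C * (u ^ n * norm (E w u))" by simp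
  also have "\<dots> \<le> C * (K1 * D1 ^ n * M n * exp (Re w) ^ n * (exp (Re w) / ((exp (Re w))\<^sup>2 + u\<^sup>2)))"
    using C_nonneg by (intro mult_left_mono norm_E_le w True)
  finally show ?thesis by (simp only: mult.assoc)
next
  case False
  then show ?thesis using C_nonneg K1_pos D1_ge_1 M_pos[of n] by (auto intro!: mult_nonneg_nonneg)
qed

lemma mult_E_measurable:
  assumes "w \<in> strip d"
  shows "(\<lambda>u. indicator {0<..} u *\<^sub>R (f u * E w u)) \<in> borel_measurable borel"
proof -
  have "(\<lambda>u. f u * (indicator {0<..} u *\<^sub>R E w u)) \<in> borel_measurable borel"
    by (intro borel_measurable_times f_meas E_measurable assms)
  moreover have "(\<lambda>u. indicator {0<..} u *\<^sub>R (f u * E w u)) = (\<lambda>u. f u * (indicator {0<..} u *\<^sub>R E w u))"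
    by (simp add: fun_eq_iff)
  ultimately show ?thesis by (simp only:)
qed

lemma set_integrable_mult_E:
  assumes w: "w \<in> strip d"
  shows "set_integrable lborel {0<..} (\<lambda>u. f u * E w u)"
  unfolding set_integrable_def
proof (rule Bochner_Integration.integrable_bound)
  show "integrable lborel (\<lambda>u. C * K1 * D1 ^ n * M n * exp (Re w) ^ n * (exp (Re w) / ((exp (Re w))\<^sup>2 + u\<^sup>2)))"
    by (intro integrable_mult_right poisson_integrable) simp
  show "AE u in lborel. norm (indicator {0<..} u *\<^sub>R (f u * E w u))
    \<le> norm (C * K1 * D1 ^ n * M n * exp (Re w) ^ n * (exp (Re w) / ((exp (Re w))\<^sup>2 + u\<^sup>2)))"
    by (intro AE_I2 order_trans[OF norm_mult_E_le[OF w]]) (simp only: real_norm_def abs_ge_self)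
qed (use mult_E_measurable[OF w] in \<open>simp only: measurable_lborel2\<close>)

text \<open>By scaling, the integral of r / (r^2 + u^2) does not depend on r, so a bound C u^n on f
  turns into a bound of order n in |z|. Order 0 serves the operator itself, order n its Taylor
  remainders.\<close>

lemma norm_kernel_transform_le:
  assumes w: "w \<in> strip d"
  shows "norm (kernel_transform f w) \<le> C * K2 * D1 ^ n * M n * exp (Re w) ^ n"
proof -
  define r where "r = exp (Re w)"
  have r: "r > 0" by (simp add: r_def)
  have "norm (kernel_transform f w) \<le> (\<integral>u. norm (indicator {0<..} u *\<^sub>R (f u * E w u)) \<partial>lborel)"
    unfolding kernel_transform_def set_lebesgue_integral_def by (rule integral_norm_bound)
  also have "\<dots> \<le> (\<integral>u. C * K1 * D1 ^ n * M n * r ^ n * (r / (r\<^sup>2 + u\<^sup>2)) \<partial>lborel)"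
    using norm_mult_E_le[OF w] set_integrable_mult_E[OF w] unfolding r_def[symmetric] set_integrable_def
    by (intro integral_mono integrable_norm integrable_mult_right poisson_integrable r)
  also have "\<dots> = C * K1 * D1 ^ n * M n * r ^ n * (\<integral>u. 1 / (1 + u\<^sup>2) \<partial>lborel)"
    using poisson_kernel_scale(2)[OF r, of "\<lambda>_. 1"] integrable_cauchy_density
    by (simp only: mult_1_left integral_mult_right_zero)
  finally show ?thesis by (simp add: K2_def r_def mult_ac)
qed

lemma kernel_transform_holomorphic: "kernel_transform f holomorphic_on strip d"
  unfolding kernel_transform_def[abs_def] set_lebesgue_integral_def
proof (rule holomorphic_on_lebesgue_integral[OF open_strip])
  show "(\<lambda>w. indicator {0<..} u *\<^sub>R (f u * E w u)) holomorphic_on strip d" for u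
  proof -
    have "(Glog M s \<circ> (\<lambda>w. w - complex_of_real (ln u))) holomorphic_on strip d"
      by (rule holomorphic_on_compose_gen[OF _ Glog_holomorphic]) (auto simp: strip_def intro!: holomorphic_intros)
    then show ?thesis
      unfolding E_def scaleR_conv_of_real o_def by (intro holomorphic_intros)
  qed
  fix w assume w: "w \<in> strip d"
  show "(\<lambda>u. indicator {0<..} u *\<^sub>R (f u * E w u)) \<in> borel_measurable lborel"
    using mult_E_measurable[OF w] by (simp only: measurable_lborel2)
  define R r where "R = exp (Re w + 1)" and "r = exp (Re w - 1)"
  have rR: "r > 0" "R > 0" by (auto simp: r_def R_def)
  have "norm (indicator {0<..} u *\<^sub>R (f u * E y u)) \<le> C * K1 * D1 ^ n * M n * R ^ n * (R / r) * (r / (r\<^sup>2 + u\<^sup>2))"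
    if y: "y \<in> ball w 1 \<inter> strip d" for y u
  proof -
    define x where "x = exp (Re y)"
    have "\<bar>Re y - Re w\<bar> \<le> 1"
      using y abs_Re_le_cmod[of "y - w"] by (auto simp: dist_norm norm_minus_commute)
    then have x: "r \<le> x" "x \<le> R" unfolding r_def R_def x_def exp_le_cancel_iff by linarith+
    have "norm (indicator {0<..} u *\<^sub>R (f u * E y u)) \<le> C * K1 * D1 ^ n * M n * x ^ n * (x / (x\<^sup>2 + u\<^sup>2))"
      using y norm_mult_E_le[of y u] by (simp add: x_def)
    also have "\<dots> \<le> C * K1 * D1 ^ n * M n * R ^ n * (R / (r\<^sup>2 + u\<^sup>2))"
    proof (intro mult_mono frac_le)
      show "r\<^sup>2 + u\<^sup>2 \<le> x\<^sup>2 + u\<^sup>2" "x ^ n \<le> R ^ n"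
        using x rR by (auto intro: power_mono)
    qed (use x rR C_nonneg K1_pos D1_ge_1 M_pos[of n] in \<open>auto simp: add_pos_nonneg\<close>)
    also have "R / (r\<^sup>2 + u\<^sup>2) = (R / r) * (r / (r\<^sup>2 + u\<^sup>2))" using rR by simp
    finally show ?thesis by (simp only: mult.assoc)
  qed
  then show "\<exists>e>0. \<exists>h. integrable lborel h \<and> (\<forall>u\<in>space lborel. \<forall>y\<in>ball w e \<inter> strip d.
      norm (indicator {0<..} u *\<^sub>R (f u * E y u)) \<le> h u)"
    using rR by (intro exI[of _ 1] conjI exI[of _ "\<lambda>u. C * K1 * D1 ^ n * M n * R ^ n * (R / r) * (r / (r\<^sup>2 + u\<^sup>2))"]
      integrable_mult_right poisson_integrable) auto
qed

end

section \<open>Moments as transforms of powers\<close>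

lemma mom_eq: "mom M s p = kernel_transform (\<lambda>u. complex_of_real (u ^ p)) 0"
  unfolding mom_def kernel_transform_def
proof (rule set_lebesgue_integral_cong, simp, intro allI impI)
  fix t :: real assume "t \<in> {0<..}"
  then have t: "t > 0" by simp
  have "t powr (real p - 1) * t = t ^ p"
    using t powr_add[of t "real p - 1" 1] by (simp add: powr_realpow)
  moreover have "elog M s (complex_of_real (ln t)) = complex_of_real t * E 0 t"
    using elog_eq[OF t, of 0] by simp
  ultimately show "complex_of_real (t powr (real p - 1)) * elog M s (complex_of_real (ln t)) = complex_of_real (t ^ p) * E 0 t"
    by (metis mult.assoc of_real_mult)
qed

text \<open>Substitute u = z t with z = exp x. For complex z this would rotate the path of
  integration, which is why the general case goes through analytic continuation.\<close>

lemma power_transform_real: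
  "kernel_transform (\<lambda>u. complex_of_real (u ^ p)) (complex_of_real x) = exp (of_nat p * complex_of_real x) * mom M s p"
proof -
  define c where "c = exp x"
  have c: "c > 0" "ln c = x" by (auto simp: c_def)
  have "kernel_transform (\<lambda>u. complex_of_real (u ^ p)) (complex_of_real x)
     = \<bar>c\<bar> *\<^sub>R (\<integral>t. indicator {0<..} (0 + c * t) *\<^sub>R (complex_of_real ((0 + c * t) ^ p) * E (complex_of_real x) (0 + c * t)) \<partial>lborel)"
    unfolding kernel_transform_def set_lebesgue_integral_def using c
    by (intro lborel_integral_real_affine) simp
  also have "\<dots> = \<bar>c\<bar> *\<^sub>R (\<integral>t. (complex_of_real (c ^ p) / complex_of_real c) * (indicator {0<..} t *\<^sub>R (complex_of_real (t ^ p) * E 0 t)) \<partial>lborel)"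
  proof (intro arg_cong[where f = "\<lambda>x. \<bar>c\<bar> *\<^sub>R x"] Bochner_Integration.integral_cong refl)
    fix t
    show "indicator {0<..} (0 + c * t) *\<^sub>R (complex_of_real ((0 + c * t) ^ p) * E (complex_of_real x) (0 + c * t))
      = (complex_of_real (c ^ p) / complex_of_real c) * (indicator {0<..} t *\<^sub>R (complex_of_real (t ^ p) * E 0 t))"
    proof (cases "t > 0")
      case True
      then have "ln (c * t) = x + ln t" using c by (simp add: ln_mult)
      then have "E (complex_of_real x) (c * t) = E 0 t / complex_of_real c"
        by (simp add: E_def c_def exp_minus exp_of_real field_simps)
      then show ?thesis using True c by (simp add: power_mult_distrib)
    next
      case False
      then have "\<not> c * t > 0" using c by (simp add: zero_less_mult_iff)
      then show ?thesis using False by simp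
    qed
  qed
  also have "\<dots> = complex_of_real (c ^ p) * mom M s p"
    using c by (simp add: mom_eq kernel_transform_def set_lebesgue_integral_def scaleR_conv_of_real)
  also have "complex_of_real (c ^ p) = exp (of_nat p * complex_of_real x)"
    by (simp add: c_def exp_of_nat_mult exp_of_real)
  finally show ?thesis .
qed

text \<open>Both sides are holomorphic in the strip and agree on the real line.\<close>
lemma power_transform:
  assumes "w \<in> strip d"
  shows "kernel_transform (\<lambda>u. complex_of_real (u ^ p)) w = exp (of_nat p * w) * mom M s p"
proof -
  define F where "F w = kernel_transform (\<lambda>u. complex_of_real (u ^ p)) w - exp (of_nat p * w) * mom M s p" for w
  have "kernel_transform (\<lambda>u. complex_of_real (u ^ p)) holomorphic_on strip d"
    by (rule kernel_transform_holomorphic[where C = 1 and n = p]) (auto simp: norm_power)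
  then have F: "F holomorphic_on strip d"
    unfolding F_def by (intro holomorphic_intros)
  have "F w = 0"
  proof (rule analytic_continuation[OF F open_strip convex_connected[OF convex_strip] _ _ _ _ assms])
    show "range complex_of_real \<subseteq> strip d" using of_real_strip by auto
    show "0 \<in> strip d" using of_real_strip[of 0] by simp
    show "0 islimpt (range complex_of_real)"
      unfolding islimpt_approachable
    proof (intro allI impI)
      fix e :: real assume "e > 0"
      then show "\<exists>x'\<in>range complex_of_real. x' \<noteq> 0 \<and> dist x' 0 < e"
        by (intro bexI[of _ "complex_of_real (e / 2)"] rangeI) auto
    qed
    show "F z = 0" if "z \<in> range complex_of_real" for z
      using that by (auto simp: F_def power_transform_real simp del: of_real_power)
  qed
  then show ?thesis by (simp add: F_def)
qed

section \<open>Lower bound for the moments\<close>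

definition c1 :: real where "c1 = exp (- C2) * quot_seq M 0 / 2"
definition c2 :: real where "c2 = exp (- C2) / 2"

lemma c1_pos: "c1 > 0" and c2_pos: "c2 > 0"
  using quot_pos[of 0] by (auto simp: c1_def c2_def)

text \<open>The integrand is nonnegative, so the interval from m_p / 2 to m_p alone gives a lower
  bound. There \<open>norm_Glog_real_ge\<close> applies because - ln t is at least - ln m_p; the
  length m_p / 2 is at least m_0 / 2, and m_p^p is at least \<open>M p\<close>.\<close>

lemma norm_mom_ge: "c1 * c2 ^ p * M p \<le> norm (mom M s p)"
proof -
  define m where "m = quot_seq M p"
  have m: "m > 0" unfolding m_def by (rule quot_pos)
  define f where "f t = t ^ p * norm (Glog M s (complex_of_real (- ln t)))" for t
  have eq: "complex_of_real (t ^ p) * E 0 t = complex_of_real (f t)" for t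
    using Glog_of_real[of "- ln t"] by (simp add: E_def f_def)
  have int: "set_integrable lborel {0<..} (\<lambda>t. complex_of_real (t ^ p) * E 0 t)"
    by (rule set_integrable_mult_E[where C = 1 and n = p]) (use of_real_strip[of 0] in \<open>auto simp: norm_power\<close>)
  then have intf: "integrable lborel (\<lambda>t. indicator {0<..} t *\<^sub>R f t)"
    unfolding eq set_integrable_def scaleR_conv_of_real of_real_mult[symmetric] complex_of_real_integrable_eq
    by simp
  have mom: "mom M s p = complex_of_real (\<integral>t. indicator {0<..} t *\<^sub>R f t \<partial>lborel)"
    unfolding mom_eq kernel_transform_def set_lebesgue_integral_def eq
    by (simp add: scaleR_conv_of_real flip: of_real_mult)
  define b where "b = (m / 2) ^ p * exp (- C2 * (real p + 1))"
  have "(\<integral>t. indicator {m/2..m} t *\<^sub>R b \<partial>lborel) \<le> (\<integral>t. indicator {0<..} t *\<^sub>R f t \<partial>lborel)"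
  proof (rule integral_mono[OF _ intf])
    fix t :: real
    show "indicator {m/2..m} t *\<^sub>R b \<le> indicator {0<..} t *\<^sub>R f t"
    proof (cases "t \<in> {m/2..m}")
      case True
      then have t: "t > 0" "m / 2 \<le> t" "t \<le> m" using m by auto
      have "exp (- C2 * (real p + 1)) \<le> norm (Glog M s (complex_of_real (- ln t)))"
        using t m by (intro norm_Glog_real_ge) (auto simp: m_def)
      then have "b \<le> f t" 
        unfolding b_def f_def using t m by (intro mult_mono power_mono) auto
      then show ?thesis using True t by simp
    next
      case False
      then show ?thesis by (auto simp: f_def indicator_def)
    qed
  qed (use m in simp)
  also have "(\<integral>t. indicator {m/2..m} t *\<^sub>R b \<partial>lborel) = m / 2 * b" using m by simp
  finally have "m / 2 * b \<le> norm (mom M s p)" unfolding mom norm_of_real by linarith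
  have "c1 * c2 ^ p * M p = exp (- C2) ^ Suc p * ((quot_seq M 0 / 2) * M p / 2 ^ p)"
    by (simp add: c1_def c2_def power_divide)
  also have "\<dots> \<le> exp (- C2) ^ Suc p * ((m / 2) * m ^ p / 2 ^ p)"
    unfolding m_def using quot_pos[of p] M_pos[of p] le_quot_power[of p]
    by (intro mult_left_mono divide_right_mono mult_mono monoD[OF quot_mono]) auto
  also have "exp (- C2) ^ Suc p = exp (- C2 * (real p + 1))"
    by (subst exp_of_nat_mult[symmetric]) (simp add: algebra_simps)
  also have "\<dots> * ((m / 2) * m ^ p / 2 ^ p) = m / 2 * b"
    by (simp add: b_def power_divide)
  finally show ?thesis using \<open>m / 2 * b \<le> norm (mom M s p)\<close> by linarith
qed

lemma mom_nonzero: "mom M s p \<noteq> 0"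
proof -
  have "c1 * c2 ^ p * M p > 0" using c1_pos c2_pos M_pos[of p] by simp
  then show ?thesis using norm_mom_ge[of p] by auto
qed

end

section \<open>The operator and its Taylor remainder\<close>

context kernel
begin

definition borel_term :: "(nat \<Rightarrow> complex) \<Rightarrow> real \<Rightarrow> nat \<Rightarrow> complex" where
  "borel_term b u p = b p / mom M s p * complex_of_real (u ^ p / fact p)"

text \<open>Extension by zero beyond \<open>R\<close> turns the integral over a bounded interval
  into a transform over the half-line, where it can be compared with the transforms of the partial
  sums.\<close>

definition borel_sum :: "real \<Rightarrow> (nat \<Rightarrow> complex) \<Rightarrow> real \<Rightarrow> complex" where
  "borel_sum R b u = (if 0 < u \<and> u < R then \<Sum>p. borel_term b u p else 0)"

lemma T_op_eq: "T_op M s R b w = kernel_transform (borel_sum R b) w"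
  unfolding T_op_def kernel_transform_def set_lebesgue_integral_def
proof (rule Bochner_Integration.integral_cong[OF refl])
  fix u :: real
  show "indicator {0<..<R} u *\<^sub>R (elog M s (complex_of_real (ln u) - w) *
      (\<Sum>p. b p / mom M s p * complex_of_real (u ^ p / fact p)) / complex_of_real u)
    = indicator {0<..} u *\<^sub>R (borel_sum R b u * E w u)"
    by (cases "0 < u \<and> u < R") (auto simp: elog_eq borel_sum_def borel_term_def[abs_def] indicator_def)
qed

definition R0 :: "real \<Rightarrow> real" where "R0 B = c2 / (2 * B)"

lemma R0_pos: "B > 0 \<Longrightarrow> R0 B > 0"
  using c2_pos by (simp add: R0_def)

definition taylor :: "(nat \<Rightarrow> complex) \<Rightarrow> nat \<Rightarrow> complex \<Rightarrow> complex" where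
  "taylor b n w = (\<Sum>p<n. b p / fact p * exp w ^ p)"

lemma borel_term_measurable [measurable]: "(\<lambda>u. borel_term b u p) \<in> borel_measurable borel"
  unfolding borel_term_def by measurable

lemma borel_sum_measurable [measurable]: "borel_sum R b \<in> borel_measurable borel"
  unfolding borel_sum_def by measurable

context
  fixes L B :: real and b :: "nat \<Rightarrow> complex"
  assumes B_pos: "B > 0" and b_bound: "\<And>p. norm (b p) \<le> L * (B ^ p * fact p * M p)"
begin

lemma L_nonneg: "L \<ge> 0"
  using order_trans[OF norm_ge_zero b_bound[of 0]] by (simp add: M_0)

lemma norm_borel_term_le:
  assumes "u \<ge> 0"
  shows "norm (borel_term b u p) \<le> L / c1 * (B / c2 * u) ^ p"
proof -
  have pos: "c1 * c2 ^ p * M p > 0" using c1_pos c2_pos M_pos[of p] by simp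
  have "norm (borel_term b u p) = norm (b p) / norm (mom M s p) * (u ^ p / fact p)"
    unfolding borel_term_def norm_mult norm_divide norm_of_real using assms by simp
  also have "\<dots> \<le> (L * (B ^ p * fact p * M p)) / (c1 * c2 ^ p * M p) * (u ^ p / fact p)"
    using assms pos norm_mom_ge[of p] b_bound[of p]
    by (intro mult_right_mono frac_le order_trans[OF norm_ge_zero b_bound]) auto
  also have "\<dots> = L / c1 * (B / c2 * u) ^ p"
    using M_pos[of p] by (simp add: power_mult_distrib power_divide)
  finally show ?thesis .
qed

lemma
  assumes "0 \<le> u" "u < R0 B"
  shows summable_borel_term: "summable (borel_term b u)"
    and norm_borel_tail_le: "norm ((\<Sum>p. borel_term b u p) - (\<Sum>p<n. borel_term b u p)) \<le> 2 * L / c1 * (B / c2 * u) ^ n"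
proof -
  define x where "x = B / c2 * u"
  have x: "0 \<le> x" "x \<le> 1 / 2"
    using assms B_pos c2_pos by (auto simp: x_def R0_def field_simps)
  have bound: "norm (borel_term b u p) \<le> L / c1 * x ^ p" for p
    unfolding x_def using assms by (intro norm_borel_term_le)
  have geo: "summable (\<lambda>p. L / c1 * x ^ p)"
    using x by (intro summable_mult summable_geometric) auto
  show sm: "summable (borel_term b u)"
    using bound by (intro summable_comparison_test'[OF geo, of 0])
  have "(\<Sum>p. borel_term b u p) - (\<Sum>p<n. borel_term b u p) = (\<Sum>p. borel_term b u (p + n))"
    using suminf_split_initial_segment[OF sm, of n] by simp
  also have "norm \<dots> \<le> (\<Sum>p. L / c1 * x ^ (p + n))"
    using bound by (intro norm_suminf_le summable_ignore_initial_segment[OF geo])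
  also have "\<dots> = L / c1 * x ^ n * (\<Sum>p. x ^ p)"
    using x by (subst suminf_mult[symmetric]) (auto intro!: summable_geometric simp: power_add mult_ac)
  also have "\<dots> \<le> L / c1 * x ^ n * 2"
    using x L_nonneg c1_pos by (intro mult_left_mono) (auto simp: suminf_geometric field_simps)
  finally show "norm ((\<Sum>p. borel_term b u p) - (\<Sum>p<n. borel_term b u p)) \<le> 2 * L / c1 * (B / c2 * u) ^ n"
    by (simp add: x_def mult_ac)
qed

text \<open>Below \<open>R0 B\<close> the tail of the series is geometric with ratio at most one half; above \<open>R0 B\<close> the
  partial sum is, since there \<open>(2 * B / c2 * u) ^ p\<close> increases with \<open>p\<close>.\<close>
lemma norm_borel_sum_diff_le:
  assumes u: "u > 0"
  shows "norm (borel_sum (R0 B) b u - (\<Sum>p<n. borel_term b u p)) \<le> 2 * L / c1 * (2 * B / c2) ^ n * u ^ n"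
proof (cases "u < R0 B")
  case True
  then have "norm (borel_sum (R0 B) b u - (\<Sum>p<n. borel_term b u p)) \<le> 2 * L / c1 * (B / c2 * u) ^ n"
    using norm_borel_tail_le[of u n] u by (simp add: borel_sum_def)
  also have "\<dots> \<le> 2 * L / c1 * (2 * B / c2 * u) ^ n"
    using B_pos c2_pos c1_pos u L_nonneg by (intro mult_left_mono power_mono mult_right_mono divide_right_mono) auto
  finally show ?thesis by (simp only: power_mult_distrib mult.assoc)
next
  case False
  define y where "y = 2 * B / c2 * u"
  have y: "y \<ge> 1"
    using False B_pos c2_pos by (auto simp: y_def R0_def field_simps)
  have "norm (borel_sum (R0 B) b u - (\<Sum>p<n. borel_term b u p)) \<le> (\<Sum>p<n. norm (borel_term b u p))"
    using False norm_sum[of "borel_term b u" "{..<n}"] by (simp add: borel_sum_def)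
  also have "\<dots> \<le> (\<Sum>p<n. L / c1 * y ^ n * (1 / 2) ^ p)"
  proof (rule sum_mono)
    fix p assume p: "p \<in> {..<n}"
    have "norm (borel_term b u p) \<le> L / c1 * (B / c2 * u) ^ p"
      using u by (intro norm_borel_term_le) auto
    also have "B / c2 * u = y * (1 / 2)" by (simp add: y_def)
    also have "L / c1 * (y * (1 / 2)) ^ p = L / c1 * y ^ p * (1 / 2) ^ p"
      by (simp only: power_mult_distrib mult.assoc)
    also have "\<dots> \<le> L / c1 * y ^ n * (1 / 2) ^ p"
      using y p L_nonneg c1_pos by (intro mult_right_mono mult_left_mono power_increasing) auto
    finally show "norm (borel_term b u p) \<le> L / c1 * y ^ n * (1 / 2) ^ p" .
  qed
  also have "\<dots> = L / c1 * y ^ n * (\<Sum>p<n. (1 / 2) ^ p)"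
    by (simp only: sum_distrib_left)
  also have "\<dots> \<le> L / c1 * y ^ n * 2"
  proof (rule mult_left_mono)
    have "(\<Sum>p<n. (1 / 2 :: real) ^ p) = 2 - 2 * (1 / 2) ^ n"
      by (induction n) auto
    then show "(\<Sum>p<n. (1 / 2 :: real) ^ p) \<le> 2" by simp
  qed (use y L_nonneg c1_pos in auto)
  also have "y ^ n = (2 * B / c2) ^ n * u ^ n" unfolding y_def by (rule power_mult_distrib)
  finally show ?thesis by (simp only: times_divide_eq_left times_divide_eq_right mult_ac)
qed

section \<open>Holomorphy, linearity and Taylor remainder of the operator\<close>

lemma norm_borel_sum_le: "u > 0 \<Longrightarrow> norm (borel_sum (R0 B) b u) \<le> 2 * L / c1 * u ^ 0"
  using norm_borel_sum_diff_le[of u 0] by simp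

lemma set_integrable_borel_sum:
  "w \<in> strip d \<Longrightarrow> set_integrable lborel {0<..} (\<lambda>u. borel_sum (R0 B) b u * E w u)"
  by (rule set_integrable_mult_E[OF borel_sum_measurable norm_borel_sum_le])

lemma T_op_holomorphic: "T_op M s (R0 B) b holomorphic_on strip d"
  unfolding T_op_eq[abs_def] by (rule kernel_transform_holomorphic[OF borel_sum_measurable norm_borel_sum_le])

lemma power_integrable:
  "w \<in> strip d \<Longrightarrow> set_integrable lborel {0<..} (\<lambda>u. complex_of_real (u ^ p) * E w u)"
  by (rule set_integrable_mult_E[where C = 1 and n = p]) (auto simp: norm_power)

lemma
  assumes w: "w \<in> strip d"
  shows partial_sum_integrable: "set_integrable lborel {0<..} (\<lambda>u. (\<Sum>p<n. borel_term b u p) * E w u)"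
    and partial_sum_transform: "kernel_transform (\<lambda>u. \<Sum>p<n. borel_term b u p) w = taylor b n w"
proof -
  have "set_integrable lborel {0<..} (\<lambda>u. (\<Sum>p<n. borel_term b u p) * E w u) \<and>
    kernel_transform (\<lambda>u. \<Sum>p<n. borel_term b u p) w = taylor b n w"
  proof (induction n)
    case 0
    then show ?case by (simp add: kernel_transform_def taylor_def set_integrable_def)
  next
    case (Suc n)
    define k where "k = b n / mom M s n / fact n"
    have term_eq: "borel_term b u n * E w u = k * (complex_of_real (u ^ n) * E w u)" for u
      by (simp add: borel_term_def k_def)
    have i: "set_integrable lborel {0<..} (\<lambda>u. borel_term b u n * E w u)"
      unfolding term_eq using power_integrable[OF w, of n] by (intro set_integrable_mult_right) auto
    have "(LINT u:{0<..}|lborel. borel_term b u n * E w u) = k * (exp (of_nat n * w) * mom M s n)"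
      unfolding term_eq using power_transform[OF w, of n] by (simp add: kernel_transform_def)
    \<comment> \<open>The moment produced by \<open>power_transform\<close> cancels the one in the
      denominator of the Borel term; this uses \<open>mom_nonzero\<close>.\<close>
    also have "\<dots> = b n / fact n * exp w ^ n"
      using mom_nonzero[of n] by (simp add: k_def exp_of_nat_mult)
    finally show ?case
      using Suc i unfolding kernel_transform_def sum.lessThan_Suc distrib_right taylor_def
      by (simp add: set_integral_add)
  qed
  then show "set_integrable lborel {0<..} (\<lambda>u. (\<Sum>p<n. borel_term b u p) * E w u)"
    "kernel_transform (\<lambda>u. \<Sum>p<n. borel_term b u p) w = taylor b n w" by auto
qed

lemma norm_T_op_remainder_le:
  assumes w: "w \<in> strip d"
  shows "norm (T_op M s (R0 B) b w - taylor b n w)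
    \<le> L * (2 * K2 / c1) * (2 * D1 / c2 * B) ^ n * M n * exp (Re w) ^ n"
proof -
  have "T_op M s (R0 B) b w - taylor b n w
      = kernel_transform (\<lambda>u. borel_sum (R0 B) b u - (\<Sum>p<n. borel_term b u p)) w"
    unfolding T_op_eq partial_sum_transform[OF w, symmetric]
    unfolding kernel_transform_def left_diff_distrib
    using set_integrable_borel_sum[OF w] partial_sum_integrable[OF w] by (simp add: set_integral_diff)
  also have "norm \<dots> \<le> (2 * L / c1 * (2 * B / c2) ^ n) * K2 * D1 ^ n * M n * exp (Re w) ^ n"
    using norm_borel_sum_diff_le by (intro norm_kernel_transform_le w) auto
  also have "\<dots> = L * (2 * K2 / c1) * (2 * D1 / c2 * B) ^ n * M n * exp (Re w) ^ n"
    by (simp add: power_mult_distrib power_divide)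
  finally show ?thesis .
qed

lemma T_op_scale:
  assumes w: "w \<in> strip d"
  shows "T_op M s (R0 B) (\<lambda>p. k * b p) w = k * T_op M s (R0 B) b w"
proof -
  have "borel_sum (R0 B) (\<lambda>p. k * b p) u = k * borel_sum (R0 B) b u" for u
    using suminf_mult[OF summable_borel_term, of u k]
    by (simp add: borel_sum_def borel_term_def mult.assoc)
  then show ?thesis by (simp add: T_op_eq kernel_transform_def mult.assoc)
qed

end

text \<open>The two sequences may have different bounds L and L', but share the radius
  \<open>R0 B\<close>. Below it both series are summable, and both transforms converge
  absolutely.\<close>

lemma T_op_add:
  assumes B: "B > 0" and b: "\<And>p. norm (b p) \<le> L * (B ^ p * fact p * M p)"
    and b': "\<And>p. norm (b' p) \<le> L' * (B ^ p * fact p * M p)" and w: "w \<in> strip d"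
  shows "T_op M s (R0 B) (\<lambda>p. b p + b' p) w = T_op M s (R0 B) b w + T_op M s (R0 B) b' w"
proof -
  have "borel_sum (R0 B) (\<lambda>p. b p + b' p) u = borel_sum (R0 B) b u + borel_sum (R0 B) b' u" for u
    using suminf_add[OF summable_borel_term[OF B b] summable_borel_term[OF B b'], of u u]
    by (simp add: borel_sum_def borel_term_def ring_distribs add_divide_distrib)
  then show ?thesis 
    using set_integrable_borel_sum[OF B b w] set_integrable_borel_sum[OF B b' w]
    by (simp add: T_op_eq kernel_transform_def distrib_right set_integral_add)
qed

end

section \<open>Derivatives on the Riemann surface of the logarithm\<close>

lemma zderiv_holomorphic:
  assumes "open S" "F holomorphic_on S"
  shows "zderiv n F holomorphic_on S"
proof (induction n)
  case (Suc n)
  then show ?case using assms(1) by (auto intro!: holomorphic_intros holomorphic_deriv)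
qed (use assms in simp)

lemma zderiv_cong:
  assumes "open S" "\<And>w. w \<in> S \<Longrightarrow> F w = G w" "w \<in> S"
  shows "zderiv n F w = zderiv n G w"
  using assms(3)
proof (induction n arbitrary: w)
  case (Suc n)
  have "eventually (\<lambda>z. z \<in> S) (nhds w)" using Suc.prems assms(1) by (rule eventually_nhds_in_open[rotated])
  then have "eventually (\<lambda>z. zderiv n F z = zderiv n G z) (nhds w)"
    by eventually_elim (rule Suc.IH)
  then have "deriv (zderiv n F) w = deriv (zderiv n G) w" by (rule deriv_cong_ev) simp
  then show ?case by simp
qed (use assms in simp)

lemma zderiv_diff:
  assumes "open S" "F holomorphic_on S" "G holomorphic_on S" "w \<in> S"
  shows "zderiv n (\<lambda>w. F w - G w) w = zderiv n F w - zderiv n G w"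
  using assms(4)
proof (induction n arbitrary: w)
  case (Suc n)
  have "zderiv (Suc n) (\<lambda>w. F w - G w) w = exp (- w) * deriv (\<lambda>w. zderiv n F w - zderiv n G w) w"
  proof -
    have "eventually (\<lambda>z. z \<in> S) (nhds w)" using Suc.prems assms(1) by (rule eventually_nhds_in_open[rotated])
    then have "eventually (\<lambda>z. zderiv n (\<lambda>w. F w - G w) z = zderiv n F z - zderiv n G z) (nhds w)"
      by eventually_elim (rule Suc.IH)
    then have "deriv (zderiv n (\<lambda>w. F w - G w)) w = deriv (\<lambda>w. zderiv n F w - zderiv n G w) w"
      by (rule deriv_cong_ev) simp
    then show ?thesis by (simp only: zderiv.simps)
  qed
  also have "\<dots> = exp (- w) * (deriv (zderiv n F) w - deriv (zderiv n G) w)"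
    using zderiv_holomorphic[OF assms(1,2)] zderiv_holomorphic[OF assms(1,3)] assms(1) Suc.prems
    by (subst deriv_diff) (blast intro: holomorphic_on_imp_differentiable_at)+
  finally show ?case by (simp only: zderiv.simps right_diff_distrib)
qed simp

text \<open>The factor exp (- w) in \<open>zderiv\<close> cancels the inner derivative of exp, so
  polynomials in z are differentiated as usual.\<close>

lemma zderiv_poly_exp: "zderiv n (\<lambda>w. poly P (exp w)) = (\<lambda>w. poly ((pderiv ^^ n) P) (exp w))"
proof (induction n)
  case (Suc n)
  have "((\<lambda>w. poly Q (exp w)) has_field_derivative poly (pderiv Q) (exp w) * exp w) (at w)" for Q and w :: complex
    by (rule DERIV_chain2[OF poly_DERIV DERIV_exp])
  then have "deriv (\<lambda>w. poly Q (exp w)) w = poly (pderiv Q) (exp w) * exp w" for Q and w :: complex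
    by (rule DERIV_imp_deriv)
  then show ?case by (simp add: Suc exp_minus fun_eq_iff)
qed simp

text \<open>The chart \<open>\<xi> \<mapsto> w + Ln \<xi>\<close> is the local coordinate \<open>\<xi> = z / z\<^sub>0\<close>, \<open>z\<^sub>0 = exp w\<close>, on the
  Riemann surface of the logarithm.\<close>
lemma higher_deriv_Ln_chart:
  assumes "open S" "F holomorphic_on S" and r: "r \<le> 1" "\<And>\<xi>. \<xi> \<in> ball 1 r \<Longrightarrow> w + Ln \<xi> \<in> S"
    and "\<xi> \<in> ball 1 r"
  shows "(deriv ^^ n) (\<lambda>\<xi>. F (w + Ln \<xi>)) \<xi> = exp (of_nat n * w) * zderiv n F (w + Ln \<xi>)"
  using assms(5)
proof (induction n arbitrary: \<xi>)
  case (Suc n)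
  have xi: "\<xi> \<notin> \<real>\<^sub>\<le>\<^sub>0" "\<xi> \<noteq> 0"
  proof -
    have "\<bar>Re (1 - \<xi>)\<bar> < 1"
      using Suc.prems r(1) abs_Re_le_cmod[of "1 - \<xi>"] by (simp add: dist_norm del: minus_complex.simps)
    then have "Re \<xi> > 0" by simp
    then show "\<xi> \<notin> \<real>\<^sub>\<le>\<^sub>0" "\<xi> \<noteq> 0" by (auto simp: complex_nonpos_Reals_iff)
  qed
  have "eventually (\<lambda>z. z \<in> ball 1 r) (nhds \<xi>)"
    using Suc.prems by (intro eventually_nhds_in_open) auto
  then have "eventually (\<lambda>z. (deriv ^^ n) (\<lambda>\<xi>. F (w + Ln \<xi>)) z = exp (of_nat n * w) * zderiv n F (w + Ln z)) (nhds \<xi>)"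
    by eventually_elim (rule Suc.IH)
  then have "(deriv ^^ Suc n) (\<lambda>\<xi>. F (w + Ln \<xi>)) \<xi> = deriv (\<lambda>z. exp (of_nat n * w) * zderiv n F (w + Ln z)) \<xi>"
    unfolding funpow.simps o_def by (rule deriv_cong_ev) simp
  also have "\<dots> = exp (of_nat n * w) * (deriv (zderiv n F) (w + Ln \<xi>) * (1 / \<xi>))"
  proof (intro DERIV_imp_deriv DERIV_cmult DERIV_chain2[of "zderiv n F"])
    show "(zderiv n F has_field_derivative deriv (zderiv n F) (w + Ln \<xi>)) (at (w + Ln \<xi>))"
      using zderiv_holomorphic[OF assms(1,2)] assms(1) r(2)[OF Suc.prems] by (rule holomorphic_derivI)
    show "((\<lambda>z. w + Ln z) has_field_derivative 1 / \<xi>) (at \<xi>)"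
      using xi by (auto intro!: derivative_eq_intros simp: inverse_eq_divide)
  qed
  also have "\<dots> = exp (of_nat (Suc n) * w) * zderiv (Suc n) F (w + Ln \<xi>)"
    using xi(2) by (simp add: exp_add exp_minus ring_distribs field_simps)
  finally show ?case .
qed simp

text \<open>Cauchy's inequality in the chart, on the disc of radius \<rho> = r / 2 about 1.
  Continuity of \<open>Ln\<close> at 1 provides r, depending only on the gap between c and d, such
  that the chart stays in the larger strip. The factor 2^q arises because |z| at most doubles on
  this disc.\<close>

lemma zderiv_Cauchy_estimate:
  assumes "c < d"
  obtains \<rho> where "\<rho> > 0" "\<And>F B q n w. F holomorphic_on strip d \<Longrightarrow>
    (\<And>w. w \<in> strip d \<Longrightarrow> norm (F w) \<le> B * exp (Re w) ^ q) \<Longrightarrow> w \<in> strip c \<Longrightarrow>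
    norm (zderiv n F w) \<le> fact n * B * 2 ^ q * exp (Re w) ^ q / (\<rho> * exp (Re w)) ^ n"
proof -
  define \<epsilon> where "\<epsilon> = (d - c) * pi / 2"
  have \<epsilon>: "\<epsilon> > 0" using assms by (simp add: \<epsilon>_def)
  have "isCont Ln 1" by (intro isCont_Ln') auto
  then obtain r' where r': "r' > 0" "\<And>\<xi>. dist \<xi> 1 < r' \<Longrightarrow> dist (Ln \<xi>) (Ln 1) < \<epsilon>"
    using \<epsilon> unfolding continuous_at_eps_delta by metis
  define r where "r = min r' 1"
  have r: "r > 0" "r \<le> 1" using r' by (auto simp: r_def)
  have chart: "w + Ln \<xi> \<in> strip d" if "w \<in> strip c" "\<xi> \<in> ball 1 r" for w \<xi>
  proof -
    have "norm (Ln \<xi>) < \<epsilon>" using r'(2)[of \<xi>] that by (simp add: r_def dist_commute)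
    then have "\<bar>Im (Ln \<xi>)\<bar> < \<epsilon>" using abs_Im_le_cmod[of "Ln \<xi>"] by linarith
    moreover have "c * pi / 2 + \<epsilon> = d * pi / 2" by (simp add: \<epsilon>_def field_simps)
    moreover have "\<bar>Im w\<bar> < c * pi / 2" using that(1) by (simp add: strip_def)
    ultimately show ?thesis unfolding strip_def mem_Collect_eq plus_complex.simps by linarith
  qed
  show ?thesis
  proof (rule that[of "r / 2"])
    fix F :: "complex \<Rightarrow> complex" and B :: real and q n :: nat and w
    assume hol: "F holomorphic_on strip d" and bound: "\<And>w. w \<in> strip d \<Longrightarrow> norm (F w) \<le> B * exp (Re w) ^ q"
      and w: "w \<in> strip c"
    define f where "f \<xi> = F (w + Ln \<xi>)" for \<xi>
    have pos: "Re \<xi> > 0" if "\<xi> \<in> ball 1 r" for \<xi>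
      using that r(2) abs_Re_le_cmod[of "1 - \<xi>"] by (simp add: dist_norm)
    have "w \<in> strip d" using w strip_mono[of c d] assms by auto
    then have "0 \<le> B * exp (Re w) ^ q" by (intro order_trans[OF norm_ge_zero bound])
    then have B: "B \<ge> 0" using mult_right_le_imp_le[of 0 "exp (Re w) ^ q" B] by simp
    have "F \<circ> (\<lambda>\<xi>. w + Ln \<xi>) holomorphic_on ball 1 r"
    proof (rule holomorphic_on_compose_gen[OF _ hol])
      show "(\<lambda>\<xi>. w + Ln \<xi>) holomorphic_on ball 1 r"
        using pos by (force intro!: holomorphic_intros simp: complex_nonpos_Reals_iff)
    qed (use chart[OF w] in auto)
    then have f_hol: "f holomorphic_on ball 1 r" by (simp add: f_def[abs_def] o_def)
    have sub: "cball 1 (r / 2) \<subseteq> ball (1::complex) r" using r by auto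
    have "norm ((deriv ^^ n) f 1) \<le> fact n * (B * (2 * exp (Re w)) ^ q) / (r / 2) ^ n"
    proof (rule Cauchy_inequality)
      show "f holomorphic_on ball 1 (r / 2)"
        using f_hol sub ball_subset_cball by (blast intro: holomorphic_on_subset)
      show "continuous_on (cball 1 (r / 2)) f"
        using f_hol sub by (meson holomorphic_on_imp_continuous_on holomorphic_on_subset)
      fix x :: complex assume x: "norm (1 - x) = r / 2"
      then have xb: "x \<in> ball 1 r" using r by (simp add: dist_norm)
      have "x \<noteq> 0" using pos[OF xb] by auto
      have "norm x \<le> 2" using norm_triangle_ineq4[of 1 "1 - x"] x r by simp
      have "norm (f x) \<le> B * exp (Re (w + Ln x)) ^ q"
        unfolding f_def by (intro bound chart w xb)
      also have "exp (Re (w + Ln x)) = norm x * exp (Re w)"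
        using \<open>x \<noteq> 0\<close> by (simp add: exp_add)
      also have "B * \<dots> ^ q \<le> B * (2 * exp (Re w)) ^ q"
        using \<open>norm x \<le> 2\<close> B by (intro mult_left_mono power_mono mult_right_mono) auto
      finally show "norm (f x) \<le> B * (2 * exp (Re w)) ^ q" .
    qed (use r in auto)
    also have "(deriv ^^ n) f 1 = exp (of_nat n * w) * zderiv n F (w + Ln 1)"
      unfolding f_def[abs_def] using r chart[OF w]
      by (intro higher_deriv_Ln_chart[OF open_strip hol]) auto
    also have "norm \<dots> = exp (Re w) ^ n * norm (zderiv n F w)"
      by (simp add: norm_mult exp_of_nat_mult norm_power)
    finally show "norm (zderiv n F w) \<le> fact n * B * 2 ^ q * exp (Re w) ^ q / (r / 2 * exp (Re w)) ^ n"
      using r by (simp add: field_simps power_mult_distrib)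
  qed (use r in simp)
qed

lemma higher_pderiv_eq_const:
  fixes P :: "'a :: field_char_0 poly"
  assumes "degree P \<le> n"
  shows "(pderiv ^^ n) P = [:fact n * coeff P n:]"
proof (rule poly_eqI)
  fix k
  show "coeff ((pderiv ^^ n) P) k = coeff [:fact n * coeff P n:] k"
    using assms by (cases k) (auto simp: coeff_higher_pderiv pochhammer_fact coeff_eq_0)
qed

text \<open>Needed to identify the \<open>Lim\<close> in \<open>asymp_Borel\<close> from
  convergence, as limits are unique only along a proper filter.\<close>

lemma to_zero_in_strip_neq_bot: "d > 0 \<Longrightarrow> to_zero_in (strip d) \<noteq> bot"
proof
  assume d: "d > 0" and "to_zero_in (strip d) = bot"
  then have "eventually (\<lambda>_. False) (to_zero_in (strip d))" by simp
  then obtain N where "\<And>w. Re w \<le> N \<Longrightarrow> w \<notin> strip d"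
    unfolding to_zero_in_def eventually_inf_principal eventually_filtercomap_at_bot_linorder by auto
  from this[of "complex_of_real N"] show False using d by (simp add: strip_def)
qed

lemma tendsto_to_zero_in:
  fixes f :: "complex \<Rightarrow> complex"
  assumes "\<And>w. w \<in> S \<Longrightarrow> norm (f w - l) \<le> C * exp (Re w)"
  shows "(f \<longlongrightarrow> l) (to_zero_in S)"
proof -
  have "filterlim Re at_bot (to_zero_in S)"
    unfolding to_zero_in_def by (rule filterlim_mono[OF filterlim_filtercomap order_refl inf_le1])
  then have "((\<lambda>w. exp (Re w)) \<longlongrightarrow> 0) (to_zero_in S)"
    by (rule filterlim_compose[OF exp_at_bot])
  then have lim: "((\<lambda>w. C * exp (Re w)) \<longlongrightarrow> 0) (to_zero_in S)"
    by (rule tendsto_mult_right_zero)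
  have "eventually (\<lambda>w. norm (f w - l) \<le> C * exp (Re w)) (to_zero_in S)"
    unfolding to_zero_in_def eventually_inf_principal using assms by (intro always_eventually) auto
  then have "((\<lambda>w. f w - l) \<longlongrightarrow> 0) (to_zero_in S)" by (rule Lim_null_comparison[OF _ lim])
  then show ?thesis by (simp add: Lim_null[symmetric])
qed

section \<open>The extension operator\<close>

lemma in_Lambda_norm_le:
  assumes "\<And>p. M p > 0" "B > 0" "in_Lambda M B a"
  shows "norm (a p) \<le> Lambda_norm M B a * (B ^ p * fact p * M p)"
proof -
  have "norm (a p) / (B ^ p * fact p * M p) \<le> Lambda_norm M B a"
    using assms(3) unfolding Lambda_norm_def in_Lambda_def by (intro cSUP_upper) auto
  then show ?thesis using assms(1)[of p] assms(2) by (simp add: divide_le_eq)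
qed

lemma in_Lambda_diff:
  assumes "\<And>p. M p > 0" "B > 0" "in_Lambda M B a" "in_Lambda M B b"
  shows "in_Lambda M B (\<lambda>p. a p - b p)"
  unfolding in_Lambda_def
proof (rule bdd_aboveI2)
  fix p
  have "norm (a p - b p) \<le> norm (a p) + norm (b p)" by (rule norm_triangle_ineq4)
  also have "\<dots> \<le> (Lambda_norm M B a + Lambda_norm M B b) * (B ^ p * fact p * M p)"
    using in_Lambda_norm_le[OF assms(1-3), of p] in_Lambda_norm_le[OF assms(1,2,4), of p]
    by (simp add: distrib_right)
  finally show "norm (a p - b p) / (B ^ p * fact p * M p) \<le> Lambda_norm M B a + Lambda_norm M B b"
    using assms(1)[of p] assms(2) by (simp add: divide_le_eq)
qed

context kernel
begin

text \<open>Cauchy estimates applied to the Taylor remainders. The remainder of order p bounds the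
  p-th derivative, since all powers of |z| cancel; the remainder of order p + 1 leaves one factor
  |z| and gives the boundary value. \<open>C\<close> and \<open>Q\<close> are chosen before B and b,
  as the uniform constant c requires.\<close>

lemma T_op_extends:
  assumes "c < d" "0 < c"
  obtains C Q where "C \<ge> 1" "Q \<ge> 0"
    "\<And>B b L p w. B > 0 \<Longrightarrow> (\<And>p. norm (b p) \<le> L * (B ^ p * fact p * M p)) \<Longrightarrow> w \<in> strip c \<Longrightarrow>
      norm (zderiv p (T_op M s (R0 B) b) w) \<le> L * Q * ((C * B) ^ p * fact p * M p)"
    "\<And>B b L. B > 0 \<Longrightarrow> (\<And>p. norm (b p) \<le> L * (B ^ p * fact p * M p)) \<Longrightarrow>
      asymp_Borel (strip c) (T_op M s (R0 B) b) = b"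
proof -
  obtain \<rho> where \<rho>: "\<rho> > 0" and est: "\<And>F B q n w. F holomorphic_on strip d \<Longrightarrow>
    (\<And>w. w \<in> strip d \<Longrightarrow> norm (F w) \<le> B * exp (Re w) ^ q) \<Longrightarrow> w \<in> strip c \<Longrightarrow>
    norm (zderiv n F w) \<le> fact n * B * 2 ^ q * exp (Re w) ^ q / (\<rho> * exp (Re w)) ^ n"
    using zderiv_Cauchy_estimate[OF assms(1)] by metis
  define Q where "Q = 2 * K2 / c1"
  define D where "D = 2 * D1 / c2"
  define C where "C = max 1 (2 * D / \<rho>)"
  have Q: "Q \<ge> 0" using K2_nonneg c1_pos by (simp add: Q_def)
  have D: "D > 0" using D1_ge_1 c2_pos by (simp add: D_def)
  have sub: "strip c \<subseteq> strip d" using assms(1) by (intro strip_mono) simp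
  have rem: "norm (zderiv p (\<lambda>w. T_op M s (R0 B) b w - taylor b n w) w)
      \<le> fact p * (L * Q * (D * B) ^ n * M n) * 2 ^ n * exp (Re w) ^ n / (\<rho> * exp (Re w)) ^ p"
    and split: "zderiv p (T_op M s (R0 B) b) w = zderiv p (\<lambda>w. T_op M s (R0 B) b w - taylor b n w) w + zderiv p (taylor b n) w"
    if B: "B > 0" "\<And>p. norm (b p) \<le> L * (B ^ p * fact p * M p)" and w: "w \<in> strip c" for B b L p n w
  proof -
    have hol: "T_op M s (R0 B) b holomorphic_on strip d" by (rule T_op_holomorphic[OF B])
    have hol': "taylor b n holomorphic_on strip d"
      unfolding taylor_def[abs_def] by (intro holomorphic_intros) auto
    show "norm (zderiv p (\<lambda>w. T_op M s (R0 B) b w - taylor b n w) w)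
      \<le> fact p * (L * Q * (D * B) ^ n * M n) * 2 ^ n * exp (Re w) ^ n / (\<rho> * exp (Re w)) ^ p"
    proof (rule est[OF _ _ w])
      show "(\<lambda>w. T_op M s (R0 B) b w - taylor b n w) holomorphic_on strip d"
        by (intro holomorphic_intros hol hol')
      show "norm (T_op M s (R0 B) b w - taylor b n w) \<le> L * Q * (D * B) ^ n * M n * exp (Re w) ^ n"
        if "w \<in> strip d" for w
        using norm_T_op_remainder_le[OF B that, of n] by (simp only: Q_def D_def)
    qed
    show "zderiv p (T_op M s (R0 B) b) w = zderiv p (\<lambda>w. T_op M s (R0 B) b w - taylor b n w) w + zderiv p (taylor b n) w"
      using zderiv_diff[OF open_strip hol hol', of w p] w sub by (auto simp: subset_iff)
  qed
  have taylor_poly: "taylor b n = (\<lambda>w. poly (\<Sum>k<n. monom (b k / fact k) k) (exp w))" for b n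
    by (simp add: fun_eq_iff taylor_def poly_sum poly_monom)
  have deg: "degree (\<Sum>k<n. monom (b k / fact k) k) \<le> m" if "n \<le> Suc m" for n m and b :: "nat \<Rightarrow> complex"
    using that by (intro degree_sum_le) (auto intro: order_trans[OF degree_monom_le])
  have coef: "coeff (\<Sum>k<n. monom (b k / fact k) k) m = (if m < n then b m / fact m else 0)" for n m and b :: "nat \<Rightarrow> complex"
    by (simp add: coeff_sum if_distrib cong: if_cong)
  \<comment> \<open>\<open>taylor b p\<close> contains only powers below p and is killed by p
    derivatives; one more term adds exactly the constant b p.\<close>
  have taylor_0: "zderiv p (taylor b p) w = 0" and taylor_1: "zderiv p (taylor b (Suc p)) w = b p" for p b w
    unfolding taylor_poly zderiv_poly_exp by (simp_all add: higher_pderiv_eq_const[OF deg] coef del: sum.lessThan_Suc)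
  show ?thesis
  proof (rule that[of C Q])
    show "C \<ge> 1" by (simp add: C_def)
    show "Q \<ge> 0" by (rule Q)
    fix B L :: real and b :: "nat \<Rightarrow> complex"
    assume B: "B > 0" "\<And>p. norm (b p) \<le> L * (B ^ p * fact p * M p)"
    have L: "L \<ge> 0" by (rule L_nonneg[OF B])
    show "norm (zderiv p (T_op M s (R0 B) b) w) \<le> L * Q * ((C * B) ^ p * fact p * M p)" if w: "w \<in> strip c" for p w
    proof -
      have "norm (zderiv p (T_op M s (R0 B) b) w)
          \<le> fact p * (L * Q * (D * B) ^ p * M p) * 2 ^ p * exp (Re w) ^ p / (\<rho> * exp (Re w)) ^ p"
        using rem[OF B w, of p p] by (simp add: split[OF B w, of p p] taylor_0)
      also have "\<dots> = L * Q * ((2 * D / \<rho> * B) ^ p * fact p * M p)"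
        using \<rho> by (simp add: power_mult_distrib power_divide)
      also have "\<dots> \<le> L * Q * ((C * B) ^ p * fact p * M p)"
        using L Q D \<rho> B(1) M_pos[of p]
        by (intro mult_left_mono mult_right_mono power_mono) (auto simp: C_def)
      finally show ?thesis .
    qed
    show "asymp_Borel (strip c) (T_op M s (R0 B) b) = b"
      unfolding asymp_Borel_def
    proof (intro ext tendsto_Lim)
      show "\<not> trivial_limit (to_zero_in (strip c))" using to_zero_in_strip_neq_bot[OF assms(2)] .
      fix p
      show "(zderiv p (T_op M s (R0 B) b) \<longlongrightarrow> b p) (to_zero_in (strip c))"
      proof (rule tendsto_to_zero_in)
        fix w assume w: "w \<in> strip c"
        have "norm (zderiv p (T_op M s (R0 B) b) w - b p)
          \<le> fact p * (L * Q * (D * B) ^ Suc p * M (Suc p)) * 2 ^ Suc p * exp (Re w) ^ Suc p / (\<rho> * exp (Re w)) ^ p"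
          using rem[OF B w, of p "Suc p"] by (simp only: split[OF B w, of p "Suc p"] taylor_1 add_diff_cancel_right')
        also have "\<dots> = fact p * (L * Q * (D * B) ^ Suc p * M (Suc p)) * 2 ^ Suc p / \<rho> ^ p * exp (Re w)"
          by (simp add: power_mult_distrib)
        finally show "norm (zderiv p (T_op M s (R0 B) b) w - b p)
          \<le> fact p * (L * Q * (D * B) ^ Suc p * M (Suc p)) * 2 ^ Suc p / \<rho> ^ p * exp (Re w)" .
      qed
    qed
  qed
qed

end

theorem mainTheorem4:
  fixes M :: "nat \<Rightarrow> real" and \<delta> \<delta>' \<delta>1 s :: real
  assumes "strongly_regular M" and "0 < \<delta>" and "\<delta> < gammaM M"
    and "\<delta> \<le> \<delta>'" and "\<delta>' < \<delta>1" and "\<delta>1 < gammaM M"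
    and "s * \<delta>1 < 1" and "1 < s * gammaM M"
  shows "\<exists>c\<ge>1. \<forall>A>0. \<exists>R0>0.
    (\<forall>a. in_Lambda M A a \<longrightarrow> in_AMA M (c * A) (strip \<delta>) (T_op M s R0 a)) \<and>
    (\<forall>a b. in_Lambda M A a \<longrightarrow> in_Lambda M A b \<longrightarrow>
        (\<forall>w\<in>strip \<delta>. T_op M s R0 (\<lambda>p. a p + b p) w = T_op M s R0 a w + T_op M s R0 b w)) \<and>
    (\<forall>a k. in_Lambda M A a \<longrightarrow>
        (\<forall>w\<in>strip \<delta>. T_op M s R0 (\<lambda>p. k * a p) w = k * T_op M s R0 a w)) \<and>
    (\<forall>a. in_Lambda M A a \<longrightarrow> (\<forall>\<epsilon>>0. \<exists>\<eta>>0. \<forall>b. in_Lambda M A b \<longrightarrow>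
        Lambda_norm M A (\<lambda>p. b p - a p) < \<eta> \<longrightarrow>
        AMA_norm M (c * A) (strip \<delta>) (\<lambda>w. T_op M s R0 b w - T_op M s R0 a w) < \<epsilon>)) \<and>
    (\<forall>a. in_Lambda M A a \<longrightarrow> asymp_Borel (strip \<delta>) (T_op M s R0 a) = a)"
proof -
  have gamma_pos: "gammaM M > 0" using assms(2,3) by linarith
  have s: "s > 0"
    using assms(8) gamma_pos mult_nonpos_nonneg[of s "gammaM M"] by linarith
  \<comment> \<open>The supremum need not be attained, but an admissible exponent g with s * g > 1
    exists strictly above 1 / s.\<close>
  have "1 / s < gammaM M" using assms(8) s by (simp add: divide_less_eq mult.commute)
  then obtain g where g: "g > 0" "P_gamma M g" "1 / s < g"
    using less_gammaM_obtains_P_gamma[OF assms(1)] by blast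
  obtain A where "moderate_growth M A" using strongly_regular_moderate_growth[OF assms(1)] .
  then interpret moderate_growth M A .
  obtain a where a: "a \<ge> 1"
    "\<And>p j. p \<le> j \<Longrightarrow> quot_seq M p / a\<^sup>2 * ((real j + 1) / (real p + 1)) powr g \<le> quot_seq M j"
    using P_gamma_quot_growth[OF g(2)] by blast
  have "1 < s * g" using g(3) s by (simp add: divide_less_eq mult.commute)
  moreover have "\<delta>1 > 0" using assms(2,4,5) by simp
  \<comment> \<open>The kernel is controlled on the sector of opening \<delta>1; since it is
    strictly larger than that of opening \<delta>, there is room for the Cauchy discs.\<close>
  ultimately interpret kernel M A g a s \<delta>1
    using a g(1) s assms(7) by unfold_locales
  have sub: "strip \<delta> \<subseteq> strip \<delta>1" using assms(4,5) by (intro strip_mono) simp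
  have "\<delta> < \<delta>1" using assms(4,5) by simp
  then obtain c Q where c: "c \<ge> 1" and Q: "Q \<ge> 0" and bound:
    "\<And>B b L p w. B > 0 \<Longrightarrow> (\<And>p. norm (b p) \<le> L * (B ^ p * fact p * M p)) \<Longrightarrow> w \<in> strip \<delta> \<Longrightarrow>
      norm (zderiv p (T_op M s (R0 B) b) w) \<le> L * Q * ((c * B) ^ p * fact p * M p)" 
    and borel: "\<And>B b L. B > 0 \<Longrightarrow> (\<And>p. norm (b p) \<le> L * (B ^ p * fact p * M p)) \<Longrightarrow>
      asymp_Borel (strip \<delta>) (T_op M s (R0 B) b) = b"
    using T_op_extends[OF _ assms(2)] by metis
  show ?thesis
  proof (rule exI[of _ c], intro conjI c allI impI)
    fix B :: real assume B: "B > 0"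
    note le = in_Lambda_norm_le[OF M_pos B]
    have AMA_le: "norm (zderiv p (T_op M s (R0 B) b) w) / ((c * B) ^ p * fact p * M p) \<le> Lambda_norm M B b * Q"
      if "in_Lambda M B b" "w \<in> strip \<delta>" for b p w
      using bound[OF B le[OF that(1)] that(2), of p] B c M_pos[of p] by (simp add: divide_le_eq)
    show "\<exists>R>0.
      (\<forall>a. in_Lambda M B a \<longrightarrow> in_AMA M (c * B) (strip \<delta>) (T_op M s R a)) \<and>
      (\<forall>a b. in_Lambda M B a \<longrightarrow> in_Lambda M B b \<longrightarrow>
        (\<forall>w\<in>strip \<delta>. T_op M s R (\<lambda>p. a p + b p) w = T_op M s R a w + T_op M s R b w)) \<and>
      (\<forall>a k. in_Lambda M B a \<longrightarrow>
        (\<forall>w\<in>strip \<delta>. T_op M s R (\<lambda>p. k * a p) w = k * T_op M s R a w)) \<and>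
      (\<forall>a. in_Lambda M B a \<longrightarrow> (\<forall>\<epsilon>>0. \<exists>\<eta>>0. \<forall>b. in_Lambda M B b \<longrightarrow>
        Lambda_norm M B (\<lambda>p. b p - a p) < \<eta> \<longrightarrow>
        AMA_norm M (c * B) (strip \<delta>) (\<lambda>w. T_op M s R b w - T_op M s R a w) < \<epsilon>)) \<and>
      (\<forall>a. in_Lambda M B a \<longrightarrow> asymp_Borel (strip \<delta>) (T_op M s R a) = a)"
    proof (rule exI[of _ "R0 B"], intro conjI allI impI ballI R0_pos[OF B])
      fix a assume a: "in_Lambda M B a"
      show "in_AMA M (c * B) (strip \<delta>) (T_op M s (R0 B) a)"
        unfolding in_AMA_def
      proof
        show "T_op M s (R0 B) a holomorphic_on strip \<delta>"
          using T_op_holomorphic[OF B le[OF a]] sub by (rule holomorphic_on_subset)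
        show "bdd_above {norm (zderiv p (T_op M s (R0 B) a) w) / ((c * B) ^ p * fact p * M p) |p w. w \<in> strip \<delta>}"
          using AMA_le[OF a] by (intro bdd_aboveI[of _ "Lambda_norm M B a * Q"]) blast
      qed
    next
      fix a b w assume "in_Lambda M B a" "in_Lambda M B b" "w \<in> strip \<delta>"
      then show "T_op M s (R0 B) (\<lambda>p. a p + b p) w = T_op M s (R0 B) a w + T_op M s (R0 B) b w"
        using T_op_add[OF B le le] sub by blast
    next
      fix a k w assume "in_Lambda M B a" "w \<in> strip \<delta>"
      then show "T_op M s (R0 B) (\<lambda>p. k * a p) w = k * T_op M s (R0 B) a w"
        using T_op_scale[OF B le] sub by blast
    next
      fix a and \<epsilon> :: real assume a: "in_Lambda M B a" and \<epsilon>: "\<epsilon> > 0"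
      show "\<exists>\<eta>>0. \<forall>b. in_Lambda M B b \<longrightarrow> Lambda_norm M B (\<lambda>p. b p - a p) < \<eta> \<longrightarrow>
        AMA_norm M (c * B) (strip \<delta>) (\<lambda>w. T_op M s (R0 B) b w - T_op M s (R0 B) a w) < \<epsilon>"
      \<comment> \<open>Adding 1 keeps the denominator positive when \<open>Q\<close> is 0.\<close>
      proof (intro exI[of _ "\<epsilon> / (Q + 1)"] conjI allI impI)
        show "\<epsilon> / (Q + 1) > 0" using \<epsilon> Q by simp
        fix b assume b: "in_Lambda M B b" and less: "Lambda_norm M B (\<lambda>p. b p - a p) < \<epsilon> / (Q + 1)"
        have ba: "in_Lambda M B (\<lambda>p. b p - a p)" by (rule in_Lambda_diff[OF M_pos B b a])
        have "T_op M s (R0 B) b w - T_op M s (R0 B) a w = T_op M s (R0 B) (\<lambda>p. b p - a p) w"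
          if "w \<in> strip \<delta>" for w
          using T_op_add[OF B le[OF ba] le[OF a], of w] that sub by auto
        \<comment> \<open>By additivity the difference is the operator applied to b - a, but only on
          the strip; openness of the strip lets the derivatives agree there too.\<close>
        then have zd: "zderiv p (\<lambda>w. T_op M s (R0 B) b w - T_op M s (R0 B) a w) w
            = zderiv p (T_op M s (R0 B) (\<lambda>p. b p - a p)) w" if "w \<in> strip \<delta>" for p w
          using that by (intro zderiv_cong[OF open_strip])
        have "AMA_norm M (c * B) (strip \<delta>) (\<lambda>w. T_op M s (R0 B) b w - T_op M s (R0 B) a w)
            \<le> Lambda_norm M B (\<lambda>p. b p - a p) * Q"
          unfolding AMA_norm_def
        proof (rule cSup_least)
          have "0 \<in> strip \<delta>" using assms(2) by (simp add: strip_def)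
          then show "{norm (zderiv p (\<lambda>w. T_op M s (R0 B) b w - T_op M s (R0 B) a w) w) / ((c * B) ^ p * fact p * M p)
              |p w. w \<in> strip \<delta>} \<noteq> {}" by blast
        qed (use zd AMA_le[OF ba] in auto)
        also have "\<dots> \<le> Lambda_norm M B (\<lambda>p. b p - a p) * (Q + 1)"
          using L_nonneg[OF B le[OF ba]] by (intro mult_left_mono) auto
        also have "\<dots> < \<epsilon>" using less Q by (simp add: less_divide_eq)
        finally show "AMA_norm M (c * B) (strip \<delta>) (\<lambda>w. T_op M s (R0 B) b w - T_op M s (R0 B) a w) < \<epsilon>" .
      qed
    next
      fix a assume "in_Lambda M B a"
      then show "asymp_Borel (strip \<delta>) (T_op M s (R0 B) a) = a"
        using borel[OF B le] by blast
    qed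
  qed
qed

end
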